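(* Let $K$ be a finite simplicial complex and let $g\colon V(K)\to\mathbb{R}$ be a real-valued map on the vertex set of $K$. Then there exists a discrete Morse function $f\colon K\to\mathbb{R}$ whose critical simplices are exactly the simplices belonging to $\mathrm{st}^{\downarrow}(w,K)$ for some strong critical vertex $w$ of $g$. Moreover, $\mathrm{core}_g(K)\cong\mathrm{core}_f(K)$, that is, the strong internal core of $K$ associated to $g$ is the internal core of $K$ associated to $f$ (where $\cong$ denotes homeomorphism).
   Context: Discrete Morse functions. Write $\sigma\prec\tau$ if $\sigma$ is a face of $\tau$ with $\dim\tau=\dim\sigma+1$. A function $f\colon K\to\mathbb{R}$ on the simplices of $K$ is a discrete Morse function if for every $\sigma\in K$ the set $M(\sigma)=\{\tau\prec\sigma: f(\tau)\ge f(\sigma)\}\cup\{\tau\succ\sigma: f(\tau)\le f(\sigma)\}$ has at most one element; $\sigma$ is critical if $M(\sigma)=\varnothing$. The pairs $\{\sigma,\tau\}$ with $M(\sigma)=\{\tau\}$ form a matching on the simplices of $K$. Vertices, links and domination. For a vertex $v$ of a simplicial complex $K$, $\mathrm{st}(v,K)$ is the set of simplices containing $v$; $K\smallsetminus v$ is the subcomplex of simplices not containing $v$; $\mathrm{lk}(v,K)$ is the subcomplex of those $\sigma\in K\smallsetminus v$ with $\sigma\cup\{v\}\in K$. A simplicial cone $a*K_0$ with apex $a\notin K_0$ consists of the simplices of $K_0$, the vertex $\{a\}$ and all $\sigma\cup\{a\}$, $\sigma\in K_0$. A vertex $v$ is dominated by $a$ in $K$ if $\mathrm{lk}(v,K)=a*K_0$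 for some subcomplex $K_0$. In that case $r_a\colon K\to K\smallsetminus v$ denotes the simplicial retraction sending $v$ to $a$ and fixing all other vertices; $|r_a|$ is a strong deformation retraction. Descending notions. For $g\colon V(K)\to\mathbb{R}$, $K_\alpha$ is the subcomplex of simplices all of whose vertices $x$ satisfy $g(x)\le\alpha$; $\mathrm{st}^{\downarrow}(v,K)=\mathrm{st}(v,K_{g(v)})$. A vertex $v$ is descending dominated if it is dominated in $K_{g(v)}$ by some vertex $a$ with $g(a)<g(v)$; otherwise it is a strong critical vertex of $g$. Strong internal core $\mathrm{core}_g(K)$. It is obtained by performing successively the internal strong collapses guided by $g$, after choosing for each descending dominated $v$ a dominating vertex $a$ with $g(a)<g(v)$. Explicitly: order the vertices $v_1,\dots,v_n$ with $g$ non-decreasing (among vertices of equal value, descending dominated ones first), let $K_i$ be the full subcomplex on $v_1,\dots,v_i$, and define spaces $Z_i$ and maps $q_i\colon|K_i|\to Z_i$ inductively from $Z_0=\varnothing$. If $v_i$ is descending dominated with chosen dominating vertex $a_i$, put $Z_i=Z_{i-1}$ and $q_i=q_{i-1}\circ|r_{a_i}|$. If $v_i$ is strong critical, let $Z_i$ be the pushout of the inclusion $|K_{i-1}|\hookrightarrow|K_i|$ and $q_{i-1}\colon|K_{i-1}|\to Z_{i-1}$, with $q_i$ the canonical map; its new cells are the images of the open simplices of $\mathrm{st}(v_i,K_i)$. Then $\mathrm{core}_g(K)=Z_n$. Internal core $\mathrm{core}_f(K)$. It is the CW-complex, with one $d$-cell for each critical $d$-simplex of $f$, obtained by performing the sequence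 of internal collapses determined by $f$. Explicitly: choose subcomplexes $\varnothing=L_0\subset L_1\subset\dots\subset L_m=K$ such that $L_j\smallsetminus L_{j-1}$ is either a single critical simplex of $f$ or a matched pair $\{\sigma\prec\tau\}$ of $f$, in which case $\sigma$ is a free face of $\tau$ in $L_j$ (i.e. $\tau$ is the only simplex of $L_j$ properly containing $\sigma$). Define $Y_j$ and $p_j\colon|L_j|\to Y_j$ from $Y_0=\varnothing$: for a matched pair put $Y_j=Y_{j-1}$ and $p_j=p_{j-1}\circ\rho_j$, where $\rho_j\colon|L_j|\to|L_{j-1}|$ is a strong deformation retraction of the elementary collapse (carrying the closed simplex $\tau$ onto the union of its proper faces other than $\sigma$); for a critical simplex $\sigma$ let $Y_j$ be the pushout of $|L_{j-1}|\hookrightarrow|L_j|$ and $p_{j-1}$, so that one cell is attached along $p_{j-1}|_{\partial\sigma}$. Then $\mathrm{core}_f(K)=Y_m$. Both cores depend on the choices made (orderings, dominating vertices, retractions); the paper suppresses these choices from the notation, and the identification $\mathrm{core}_g(K)\cong\mathrm{core}_f(K)$ is understood for corresponding choices. *)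

theory Defs
  imports "HOL-Analysis.Analysis"
begin

section \<open>Abstract simplicial complexes\<close>

text \<open>Simplices are nonempty finite sets of vertices; the empty simplex is not a simplex.\<close>

definition abs_complex :: "'v set set \<Rightarrow> bool" where
  "abs_complex K \<longleftrightarrow>
     (\<forall>\<sigma>\<in>K. finite \<sigma> \<and> \<sigma> \<noteq> {}) \<and> (\<forall>\<sigma>\<in>K. \<forall>\<tau>. \<tau> \<subseteq> \<sigma> \<and> \<tau> \<noteq> {} \<longrightarrow> \<tau> \<in> K)"

definition subcomplex :: "'v set set \<Rightarrow> 'v set set \<Rightarrow> bool" where
  "subcomplex L K \<longleftrightarrow> abs_complex L \<and> L \<subseteq> K"

definition vertices :: "'v set set \<Rightarrow> 'v set" where
  "vertices K = {v. {v} \<in> K}"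

definition full_subcomplex :: "'v set set \<Rightarrow> 'v set \<Rightarrow> 'v set set" where
  "full_subcomplex K W = {\<sigma> \<in> K. \<sigma> \<subseteq> W}"

definition star :: "'v \<Rightarrow> 'v set set \<Rightarrow> 'v set set" where
  "star v K = {\<sigma> \<in> K. v \<in> \<sigma>}"

definition deletion :: "'v set set \<Rightarrow> 'v \<Rightarrow> 'v set set" where
  "deletion K v = {\<sigma> \<in> K. v \<notin> \<sigma>}"

definition link :: "'v \<Rightarrow> 'v set set \<Rightarrow> 'v set set" where
  "link v K = {\<sigma> \<in> deletion K v. \<sigma> \<union> {v} \<in> K}"

definition simplicial_cone :: "'v \<Rightarrow> 'v set set \<Rightarrow> 'v set set" where
  "simplicial_cone a K0 = K0 \<union> {{a}} \<union> {\<sigma> \<union> {a} | \<sigma>. \<sigma> \<in> K0}"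

text \<open>\<open>K0\<close> may be empty, in which case the link of \<open>v\<close> is the single vertex \<open>a\<close>.\<close>

definition dominated_by :: "'v set set \<Rightarrow> 'v \<Rightarrow> 'v \<Rightarrow> bool" where
  "dominated_by K v a \<longleftrightarrow> v \<in> vertices K \<and>
     (\<exists>K0. subcomplex K0 K \<and> a \<notin> vertices K0 \<and> link v K = simplicial_cone a K0)"


section \<open>Discrete Morse functions\<close>

definition facet_of :: "'v set \<Rightarrow> 'v set \<Rightarrow> bool"  (infix \<open>\<prec>\<^sub>s\<close> 50) where
  "\<sigma> \<prec>\<^sub>s \<tau> \<longleftrightarrow> \<sigma> \<subseteq> \<tau> \<and> card \<tau> = card \<sigma> + 1"

definition morse_set :: "'v set set \<Rightarrow> ('v set \<Rightarrow> real) \<Rightarrow> 'v set \<Rightarrow> 'v set set" where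
  "morse_set K f \<sigma> =
     {\<tau> \<in> K. \<tau> \<prec>\<^sub>s \<sigma> \<and> f \<tau> \<ge> f \<sigma>} \<union> {\<tau> \<in> K. \<sigma> \<prec>\<^sub>s \<tau> \<and> f \<tau> \<le> f \<sigma>}"

definition discrete_morse :: "'v set set \<Rightarrow> ('v set \<Rightarrow> real) \<Rightarrow> bool" where
  "discrete_morse K f \<longleftrightarrow>
     (\<forall>\<sigma>\<in>K. finite (morse_set K f \<sigma>) \<and> card (morse_set K f \<sigma>) \<le> 1)"

definition critical_simplices :: "'v set set \<Rightarrow> ('v set \<Rightarrow> real) \<Rightarrow> 'v set set" where
  "critical_simplices K f = {\<sigma> \<in> K. morse_set K f \<sigma> = {}}"

definition matched_pair :: "'v set set \<Rightarrow> ('v set \<Rightarrow> real) \<Rightarrow> 'v set \<Rightarrow> 'v set \<Rightarrow> bool" where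
  "matched_pair K f \<sigma> \<tau> \<longleftrightarrow> \<sigma> \<in> K \<and> \<tau> \<in> K \<and> \<sigma> \<prec>\<^sub>s \<tau> \<and> morse_set K f \<sigma> = {\<tau>}"


section \<open>Descending notions for a vertex function\<close>

definition sublevel :: "'v set set \<Rightarrow> ('v \<Rightarrow> real) \<Rightarrow> real \<Rightarrow> 'v set set" where
  "sublevel K g \<alpha> = {\<sigma> \<in> K. \<forall>x\<in>\<sigma>. g x \<le> \<alpha>}"

definition desc_star :: "'v set set \<Rightarrow> ('v \<Rightarrow> real) \<Rightarrow> 'v \<Rightarrow> 'v set set" where
  "desc_star K g v = star v (sublevel K g (g v))"

definition desc_dominated_by :: "'v set set \<Rightarrow> ('v \<Rightarrow> real) \<Rightarrow> 'v \<Rightarrow> 'v \<Rightarrow> bool" where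
  "desc_dominated_by K g v a \<longleftrightarrow> dominated_by (sublevel K g (g v)) v a \<and> g a < g v"

definition desc_dominated :: "'v set set \<Rightarrow> ('v \<Rightarrow> real) \<Rightarrow> 'v \<Rightarrow> bool" where
  "desc_dominated K g v \<longleftrightarrow> (\<exists>a. desc_dominated_by K g v a)"

definition strong_critical :: "'v set set \<Rightarrow> ('v \<Rightarrow> real) \<Rightarrow> 'v set" where
  "strong_critical K g = {v \<in> vertices K. \<not> desc_dominated K g v}"


section \<open>Geometric realization\<close>

text \<open>Points are given by their barycentric coordinates. The space \<^term>\<open>UNIV :: ('v \<Rightarrow> real) set\<close>
  carries the product topology, which for a finite complex induces the usual topology of \<open>|K|\<close>.\<close>

definition supp :: "('v \<Rightarrow> real) \<Rightarrow> 'v set" where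
  "supp x = {v. x v \<noteq> 0}"

definition realization :: "'v set set \<Rightarrow> ('v \<Rightarrow> real) set" where
  "realization K = {x. supp x \<in> K \<and> (\<forall>v. x v \<ge> 0) \<and> (\<Sum>v\<in>supp x. x v) = 1}"

text \<open>The affine extension of a vertex map to barycentric coordinates.\<close>

definition realization_map :: "('v \<Rightarrow> 'v) \<Rightarrow> ('v \<Rightarrow> real) \<Rightarrow> ('v \<Rightarrow> real)" where
  "realization_map \<phi> x = (\<lambda>u. \<Sum>w\<in>{w \<in> supp x. \<phi> w = u}. x w)"

text \<open>The retraction sending \<open>v\<close> to \<open>a\<close> and fixing all other vertices.\<close>

definition domination_retraction :: "'v \<Rightarrow> 'v \<Rightarrow> ('v \<Rightarrow> real) \<Rightarrow> ('v \<Rightarrow> real)" where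
  "domination_retraction v a = realization_map (id(v := a))"

definition strong_deformation_retraction ::
    "('a::topological_space) set \<Rightarrow> 'a set \<Rightarrow> ('a \<Rightarrow> 'a) \<Rightarrow> bool" where
  "strong_deformation_retraction S T r \<longleftrightarrow>
     retraction S T r \<and> homotopic_with_canon (\<lambda>h. \<forall>x\<in>T. h x = x) S S id r"


section \<open>Pushouts along an inclusion of a subspace\<close>

text \<open>For \<open>A \<subseteq> X\<close> and \<open>q : A \<rightarrow> Y\<close>, with \<open>Y\<close> disjoint from \<open>X - A\<close>, the pushout of \<open>A \<hookrightarrow> X\<close>
  and \<open>q\<close> is realized on the set \<open>Y \<union> (X - A)\<close>, which represents every class of the quotient of
  the disjoint sum exactly once. Its topology is the quotient topology, i.e. the finest one making
  both canonical maps continuous (the inclusion of \<open>Y\<close> and \<^term>\<open>pushout_map A q\<close> on \<open>X\<close>).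
  The iterated pushouts below thereby all live on the one type of barycentric coordinates;
  the disjointness holds for them by \<open>topspace_strong_stage\<close> and \<open>topspace_collapse_stage\<close>.\<close>

definition pushout_map :: "'p set \<Rightarrow> ('p \<Rightarrow> 'p) \<Rightarrow> 'p \<Rightarrow> 'p" where
  "pushout_map A q x = (if x \<in> A then q x else x)"

definition pushout_space :: "'p topology \<Rightarrow> 'p set \<Rightarrow> ('p \<Rightarrow> 'p) \<Rightarrow> 'p topology \<Rightarrow> 'p topology" where
  "pushout_space X A q Y = topology (\<lambda>U. U \<subseteq> topspace Y \<union> (topspace X - A) \<and>
     openin Y (topspace Y \<inter> U) \<and> openin X {x \<in> topspace X. pushout_map A q x \<in> U})"

lemma openin_pushout_space:
  "openin (pushout_space X A q Y) U \<longleftrightarrow> U \<subseteq> topspace Y \<union> (topspace X - A) \<and>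
     openin Y (topspace Y \<inter> U) \<and> openin X {x \<in> topspace X. pushout_map A q x \<in> U}"
proof -
  let ?P = "\<lambda>U. U \<subseteq> topspace Y \<union> (topspace X - A) \<and>
     openin Y (topspace Y \<inter> U) \<and> openin X {x \<in> topspace X. pushout_map A q x \<in> U}"
  have "istopology ?P"
    unfolding istopology_def
  proof (intro conjI allI impI)
    fix S T assume S: "?P S" and T: "?P T"
    have e1: "topspace Y \<inter> (S \<inter> T) = (topspace Y \<inter> S) \<inter> (topspace Y \<inter> T)" by auto
    have e2: "{x \<in> topspace X. pushout_map A q x \<in> S \<inter> T} =
      {x \<in> topspace X. pushout_map A q x \<in> S} \<inter> {x \<in> topspace X. pushout_map A q x \<in> T}" by auto
    show "openin Y (topspace Y \<inter> (S \<inter> T))" unfolding e1 using S T by blast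
    show "openin X {x \<in> topspace X. pushout_map A q x \<in> S \<inter> T}" unfolding e2 using S T by blast
    show "S \<inter> T \<subseteq> topspace Y \<union> (topspace X - A)" using S by blast
  next
    fix \<K> assume K: "\<forall>S\<in>\<K>. ?P S"
    have e1: "topspace Y \<inter> \<Union>\<K> = (\<Union>S\<in>\<K>. topspace Y \<inter> S)" by auto
    have e2: "{x \<in> topspace X. pushout_map A q x \<in> \<Union>\<K>} =
      (\<Union>S\<in>\<K>. {x \<in> topspace X. pushout_map A q x \<in> S})" by auto
    show "openin Y (topspace Y \<inter> \<Union>\<K>)" unfolding e1 using K by blast
    show "openin X {x \<in> topspace X. pushout_map A q x \<in> \<Union>\<K>}" unfolding e2 using K by blast
    show "\<Union>\<K> \<subseteq> topspace Y \<union> (topspace X - A)" using K by blast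
  qed
  then show ?thesis
    unfolding pushout_space_def by simp
qed

lemma topspace_pushout_space:
  assumes "q ` (topspace X \<inter> A) \<subseteq> topspace Y"
  shows "topspace (pushout_space X A q Y) = topspace Y \<union> (topspace X - A)"
proof -
  have "{x \<in> topspace X. pushout_map A q x \<in> topspace Y \<union> (topspace X - A)} = topspace X"
    using assms by (auto simp: pushout_map_def)
  moreover have "topspace Y \<inter> (topspace Y \<union> (topspace X - A)) = topspace Y"
    by auto
  ultimately have "openin (pushout_space X A q Y) (topspace Y \<union> (topspace X - A))"
    by (simp add: openin_pushout_space)
  then show ?thesis
    by (meson openin_pushout_space openin_subset openin_topspace subset_antisym)
qed

text \<open>The universal property (uniqueness of \<open>h\<close> is clear, the two maps being jointly surjective).\<close>

lemma pushout_space_universal: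
  fixes T :: "'b topology"
  assumes A: "A \<subseteq> topspace X" and disj: "topspace Y \<inter> (topspace X - A) = {}"
    and q: "continuous_map (subtopology X A) Y q"
  shows "continuous_map Y (pushout_space X A q Y) id"
    and "continuous_map X (pushout_space X A q Y) (pushout_map A q)"
    and "\<And>u w. \<lbrakk>continuous_map X T u; continuous_map Y T w; \<And>x. x \<in> A \<Longrightarrow> u x = w (q x)\<rbrakk>
      \<Longrightarrow> \<exists>h. continuous_map (pushout_space X A q Y) T h \<and>
             (\<forall>y\<in>topspace Y. h y = w y) \<and> (\<forall>x\<in>topspace X. h (pushout_map A q x) = u x)"
proof -
  let ?Z = "pushout_space X A q Y"
  have qA: "q ` (topspace X \<inter> A) \<subseteq> topspace Y"
    using continuous_map_image_subset_topspace[OF q] by (simp add: Int_commute)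
  note top = topspace_pushout_space[OF qA]
  have qm: "pushout_map A q x \<in> topspace ?Z" if "x \<in> topspace X" for x
    using that qA unfolding top by (auto simp: pushout_map_def)
  have "openin Y {y \<in> topspace Y. id y \<in> U}" if "openin ?Z U" for U
  proof -
    have "{y \<in> topspace Y. id y \<in> U} = topspace Y \<inter> U" by auto
    then show ?thesis using that by (simp add: openin_pushout_space)
  qed
  then show "continuous_map Y ?Z id"
    unfolding continuous_map_def using top by auto
  show "continuous_map X ?Z (pushout_map A q)"
    unfolding continuous_map_def using qm by (auto simp: openin_pushout_space)
  fix u w assume u: "continuous_map X T u" and w: "continuous_map Y T w"
    and uw: "\<And>x. x \<in> A \<Longrightarrow> u x = w (q x)"
  define h where "h z = (if z \<in> topspace Y then w z else u z)" for z
  have hY: "h y = w y" if "y \<in> topspace Y" for y using that by (simp add: h_def)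
  have hX: "h (pushout_map A q x) = u x" if "x \<in> topspace X" for x
    using that qA disj uw A by (auto simp: h_def pushout_map_def)
  have "continuous_map ?Z T h"
    unfolding continuous_map_def
  proof (intro conjI allI impI)
    show "h \<in> topspace ?Z \<rightarrow> topspace T"
      using u w unfolding top by (auto simp: h_def continuous_map_def)
    fix U assume U: "openin T U"
    let ?V = "{z \<in> topspace ?Z. h z \<in> U}"
    have e1: "topspace Y \<inter> ?V = {y \<in> topspace Y. w y \<in> U}" using hY top by auto
    have e2: "{x \<in> topspace X. pushout_map A q x \<in> ?V} = {x \<in> topspace X. u x \<in> U}"
      using hX qm by auto
    show "openin ?Z ?V"
      unfolding openin_pushout_space e1 e2
      using u w U top by (auto simp: continuous_map_def)
  qed
  then show "\<exists>h. continuous_map ?Z T h \<and>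
             (\<forall>y\<in>topspace Y. h y = w y) \<and> (\<forall>x\<in>topspace X. h (pushout_map A q x) = u x)"
    using hX hY by blast
qed


section \<open>The strong internal core\<close>

text \<open>The choices entering the strong internal core: an enumeration \<open>vs\<close> of the vertices and a
  choice \<open>a\<close> of a dominating vertex for each descending dominated vertex.\<close>

definition strong_core_choice ::
    "'v set set \<Rightarrow> ('v \<Rightarrow> real) \<Rightarrow> 'v list \<Rightarrow> ('v \<Rightarrow> 'v) \<Rightarrow> bool" where
  "strong_core_choice K g vs a \<longleftrightarrow>
     distinct vs \<and> set vs = vertices K \<and>
     (\<forall>i j. i < j \<and> j < length vs \<longrightarrow> g (vs ! i) \<le> g (vs ! j)) \<and>
     (\<forall>i j. i < j \<and> j < length vs \<and> g (vs ! i) = g (vs ! j) \<and> desc_dominated K g (vs ! j)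
        \<longrightarrow> desc_dominated K g (vs ! i)) \<and>
     (\<forall>v\<in>vertices K. desc_dominated K g v \<longrightarrow> desc_dominated_by K g v (a v))"

definition initial_complex :: "'v set set \<Rightarrow> 'v list \<Rightarrow> nat \<Rightarrow> 'v set set" where
  "initial_complex K vs i = full_subcomplex K (set (take i vs))"

text \<open>The stage \<open>i\<close> is the pair of the space \<open>Z\<^sub>i\<close> and the map \<open>q\<^sub>i : |K\<^sub>i| \<rightarrow> Z\<^sub>i\<close>; the vertex
  \<open>v\<^sub>i\<^sub>+\<^sub>1\<close> is \<open>vs ! i\<close>. The values of \<open>q\<^sub>i\<close> outside \<open>|K\<^sub>i|\<close> are irrelevant.\<close>

primrec strong_stage ::
    "'v set set \<Rightarrow> ('v \<Rightarrow> real) \<Rightarrow> 'v list \<Rightarrow> ('v \<Rightarrow> 'v) \<Rightarrow> nat \<Rightarrow>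
      ('v \<Rightarrow> real) topology \<times> (('v \<Rightarrow> real) \<Rightarrow> ('v \<Rightarrow> real))" where
  "strong_stage K g vs a 0 = (top_of_set {}, id)"
| "strong_stage K g vs a (Suc i) =
     (let (Z, q) = strong_stage K g vs a i; v = vs ! i in
      if desc_dominated K g v then (Z, q \<circ> domination_retraction v (a v))
      else (pushout_space (top_of_set (realization (initial_complex K vs (Suc i))))
              (realization (initial_complex K vs i)) q Z,
            pushout_map (realization (initial_complex K vs i)) q))"

definition strong_core ::
    "'v set set \<Rightarrow> ('v \<Rightarrow> real) \<Rightarrow> 'v list \<Rightarrow> ('v \<Rightarrow> 'v) \<Rightarrow> ('v \<Rightarrow> real) topology" where
  "strong_core K g vs a = fst (strong_stage K g vs a (length vs))"


section \<open>The internal core\<close>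

definition free_face :: "'v set set \<Rightarrow> 'v set \<Rightarrow> 'v set \<Rightarrow> bool" where
  "free_face L \<sigma> \<tau> \<longleftrightarrow> \<sigma> \<in> L \<and> {\<rho> \<in> L. \<sigma> \<subset> \<rho>} = {\<tau>}"

text \<open>The choices entering the internal core: the filtration \<open>L 0 \<subset> \<dots> \<subset> L m\<close> and, for each
  elementary collapse of \<open>L (Suc j)\<close> onto \<open>L j\<close>, the retraction \<open>\<rho> j\<close>.\<close>

definition internal_core_choice ::
    "'v set set \<Rightarrow> ('v set \<Rightarrow> real) \<Rightarrow> nat \<Rightarrow> (nat \<Rightarrow> 'v set set) \<Rightarrow>
      (nat \<Rightarrow> ('v \<Rightarrow> real) \<Rightarrow> ('v \<Rightarrow> real)) \<Rightarrow> bool" where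
  "internal_core_choice K f m L \<rho> \<longleftrightarrow>
     L 0 = {} \<and> L m = K \<and> (\<forall>j\<le>m. subcomplex (L j) K) \<and>
     (\<forall>j<m. L j \<subset> L (Suc j) \<and>
       ((\<exists>\<sigma>\<in>critical_simplices K f. L (Suc j) - L j = {\<sigma>}) \<or>
        (\<exists>\<sigma> \<tau>. matched_pair K f \<sigma> \<tau> \<and> L (Suc j) - L j = {\<sigma>, \<tau>} \<and>
           free_face (L (Suc j)) \<sigma> \<tau> \<and>
           strong_deformation_retraction (realization (L (Suc j))) (realization (L j)) (\<rho> j) \<and>
           \<rho> j ` realization {\<mu>. \<mu> \<noteq> {} \<and> \<mu> \<subseteq> \<tau>} =
             realization {\<mu>. \<mu> \<noteq> {} \<and> \<mu> \<subset> \<tau> \<and> \<mu> \<noteq> \<sigma>})))"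

text \<open>The stage \<open>j\<close> is the pair of the space \<open>Y\<^sub>j\<close> and the map \<open>p\<^sub>j : |L\<^sub>j| \<rightarrow> Y\<^sub>j\<close>. Under
  \<^const>\<open>internal_core_choice\<close>, a critical simplex is added exactly if one simplex is added.\<close>

primrec collapse_stage ::
    "(nat \<Rightarrow> 'v set set) \<Rightarrow> (nat \<Rightarrow> ('v \<Rightarrow> real) \<Rightarrow> ('v \<Rightarrow> real)) \<Rightarrow> nat \<Rightarrow>
      ('v \<Rightarrow> real) topology \<times> (('v \<Rightarrow> real) \<Rightarrow> ('v \<Rightarrow> real))" where
  "collapse_stage L \<rho> 0 = (top_of_set {}, id)"
| "collapse_stage L \<rho> (Suc j) =
     (let (Y, p) = collapse_stage L \<rho> j in
      if \<exists>\<sigma>. L (Suc j) - L j = {\<sigma>}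
      then (pushout_space (top_of_set (realization (L (Suc j)))) (realization (L j)) p Y,
            pushout_map (realization (L j)) p)
      else (Y, p \<circ> \<rho> j))"

definition internal_core ::
    "nat \<Rightarrow> (nat \<Rightarrow> 'v set set) \<Rightarrow> (nat \<Rightarrow> ('v \<Rightarrow> real) \<Rightarrow> ('v \<Rightarrow> real)) \<Rightarrow> ('v \<Rightarrow> real) topology" where
  "internal_core m L \<rho> = fst (collapse_stage L \<rho> m)"


section \<open>Sanity of the construction\<close>

lemma topspace_pushout_subset:
  "topspace (pushout_space X A q Y) \<subseteq> topspace Y \<union> (topspace X - A)"
  using openin_pushout_space[of X A q Y "topspace (pushout_space X A q Y)"] by simp

lemma topspace_strong_stage:
  "topspace (fst (strong_stage K g vs a i)) \<subseteq> realization (initial_complex K vs i)"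
proof (induction i)
  case (Suc i)
  have sub: "realization (initial_complex K vs i) \<subseteq> realization (initial_complex K vs (Suc i))"
    using set_take_subset_set_take[of i "Suc i" vs]
    by (auto simp: realization_def initial_complex_def full_subcomplex_def)
  obtain Z q where Z: "strong_stage K g vs a i = (Z, q)" by fastforce
  show ?case
    using Suc sub
      topspace_pushout_subset[of "top_of_set (realization (initial_complex K vs (Suc i)))"
        "realization (initial_complex K vs i)" q Z]
    by (auto simp: Z Let_def)
qed simp

lemma topspace_collapse_stage:
  assumes "\<forall>j<m. L j \<subset> L (Suc j)" and "j \<le> m"
  shows "topspace (fst (collapse_stage L \<rho> j)) \<subseteq> realization (L j)"
  using assms(2)
proof (induction j)
  case (Suc j)
  have sub: "realization (L j) \<subseteq> realization (L (Suc j))"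
  proof -
    have "L j \<subseteq> L (Suc j)" using assms(1) Suc.prems Suc_le_lessD by blast
    then show ?thesis by (auto simp: realization_def)
  qed
  obtain Y p where Y: "collapse_stage L \<rho> j = (Y, p)" by fastforce
  show ?case
    using Suc sub
      topspace_pushout_subset[of "top_of_set (realization (L (Suc j)))" "realization (L j)" p Y]
    by (auto simp: Y Let_def)
qed simp

lemma ex_strong_core_choice:
  assumes "finite K" "abs_complex K"
  shows "\<exists>vs a. strong_core_choice K g vs a"
proof -
  have "vertices K \<subseteq> \<Union>K" by (auto simp: vertices_def)
  moreover have "finite (\<Union>K)" using assms by (auto simp: abs_complex_def)
  ultimately have fin: "finite (vertices K)" by (rule finite_subset)
  then obtain xs where xs: "set xs = vertices K" "distinct xs"
    using finite_distinct_list by blast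
  let ?d = "\<lambda>v. if desc_dominated K g v then 0 else 1 :: nat"
  define vs where "vs = sort_key g (sort_key ?d xs)"
  have set: "set vs = vertices K" "distinct vs"
    using xs by (auto simp: vs_def)
  have srt: "sorted (map g vs)" by (simp add: vs_def)
  have ord: "g (vs ! i) \<le> g (vs ! j)" if "i < j" "j < length vs" for i j
    using srt that sorted_nth_mono[of "map g vs" i j] by simp
  have lev: "sorted (map ?d (filter (\<lambda>v. g v = c) vs))" for c
  proof -
    have "filter (\<lambda>v. g v = c) vs = filter (\<lambda>v. g v = c) (sort_key ?d xs)"
      unfolding vs_def by (rule sort_key_stable)
    then show ?thesis
      by (metis (no_types, lifting) sorted_filter sorted_sort_key)
  qed
  have dd: "desc_dominated K g (vs ! i)"
    if ij: "i < j" "j < length vs" and eq: "g (vs ! i) = g (vs ! j)"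
      and dj: "desc_dominated K g (vs ! j)" for i j
  proof -
    let ?P = "\<lambda>v. g v = g (vs ! j)"
    have "vs = take i vs @ vs ! i # drop (Suc i) vs"
      using ij by (simp add: id_take_nth_drop)
    then have "filter ?P vs = filter ?P (take i vs) @ vs ! i # filter ?P (drop (Suc i) vs)"
      using eq by (metis (mono_tags, lifting) filter.simps(2) filter_append)
    moreover have "vs ! j \<in> set (drop (Suc i) vs)"
    proof -
      have "j - Suc i < length (drop (Suc i) vs)" "drop (Suc i) vs ! (j - Suc i) = vs ! j"
        using ij by simp_all
      then show ?thesis by (metis nth_mem)
    qed
    moreover have "sorted (map ?d (filter ?P vs))" by (rule lev)
    ultimately have "\<forall>y\<in>set (filter ?P (drop (Suc i) vs)). ?d (vs ! i) \<le> ?d y"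
      by (simp only: map_append list.map sorted_append sorted_simps set_map ball_simps)
        (elim conjE, assumption)
    moreover have "vs ! j \<in> set (filter ?P (drop (Suc i) vs))"
      using \<open>vs ! j \<in> set (drop (Suc i) vs)\<close> by simp
    ultimately have "?d (vs ! i) \<le> ?d (vs ! j)" by blast
    then show ?thesis using dj by (simp split: if_splits)
  qed
  define a where "a v = (SOME b. desc_dominated_by K g v b)" for v
  have "desc_dominated_by K g v (a v)" if "desc_dominated K g v" for v
    using that unfolding desc_dominated_def a_def by (rule someI_ex)
  then have "strong_core_choice K g vs a"
    unfolding strong_core_choice_def using set ord dd by blast
  then show ?thesis by blast
qed

end

theory Submission
  imports Defs
begin

text \<open>
  If \<open>v\<close> is descending dominated by \<open>a\<close>, the simplices entering with \<open>v\<close> are matched as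
  \<open>{\<sigma>, \<sigma> \<union> {a}}\<close> and removed by elementary collapses in order of decreasing dimension; the
  simplices entering with a strong critical vertex remain critical. A discrete Morse function is
  then given by the index of the filtration step at which a simplex appears.

  The composite \<open>R\<close> of the elementary retractions cannot be chosen equal to \<open>r\<^sub>a\<close> in general, so the
  attaching maps of the two cores differ. However, \<open>R = r\<^sub>a \<circ> d\<close>, where \<open>d\<close> preserves
  every closed simplex and is the end \<open>t = 0\<close> of a pseudo-isotopy: a continuous family that for
  \<open>t > 0\<close> consists of support-preserving bijections. Inductively \<open>\<phi> \<circ> p\<^sub>i = q\<^sub>i \<circ> c\<close> on \<open>|K\<^sub>i|\<close> for a
  homeomorphism \<open>\<phi>\<close> of the two stages and the end \<open>c\<close> of such a pseudo-isotopy. Over a dominated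
  vertex, \<open>c\<close> lifts through \<open>r\<^sub>a\<close> by dividing the mass at \<open>a\<close> between \<open>v\<close> and \<open>a\<close> in the old
  proportion. Over a strong critical vertex \<open>u\<close>, \<open>c\<close> is coned off, using the time parameter
  \<open>x\<^sub>u\<close> as cone coordinate: the extension is then bijective on the open star of \<open>u\<close> already at
  time \<open>0\<close>, and by compactness it induces a homeomorphism of the two pushouts.
\<close>

section \<open>Realizations\<close>

text \<open>The sum over the varying support becomes a sum over one fixed finite set, so the mass
  condition turns into a single linear equation in the coordinates.\<close>

lemma realization_iff:
  assumes "finite V" "\<Union>K \<subseteq> V"
  shows "x \<in> realization K \<longleftrightarrow> supp x \<in> K \<and> (\<forall>v. 0 \<le> x v) \<and> sum x V = 1"
proof -
  have "sum x (supp x) = sum x V" if "supp x \<in> K"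
    by (rule sum.mono_neutral_left) (use that assms in \<open>auto simp: supp_def\<close>)
  then show ?thesis by (auto simp: realization_def)
qed

lemma realization_mono: "A \<subseteq> B \<Longrightarrow> realization A \<subseteq> realization B"
  by (auto simp: realization_def)

lemma realization_empty [simp]: "realization {} = {}"
  by (simp add: realization_def)

lemma realization_le_1:
  assumes "finite V" "\<Union>K \<subseteq> V" "x \<in> realization K"
  shows "x w \<le> 1"
proof (cases "w \<in> V")
  case True
  have "x w \<le> sum x V"
    using assms True realization_iff[OF assms(1,2), of x] by (intro member_le_sum) auto
  then show ?thesis using assms realization_iff[OF assms(1,2), of x] by auto
next
  case False
  then have "x w = 0" using assms realization_iff[OF assms(1,2), of x] by (auto simp: supp_def)
  then show ?thesis by simp
qed

lemma abs_complexD: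
  assumes "abs_complex K" "\<sigma> \<in> K"
  shows "finite \<sigma>" "\<sigma> \<noteq> {}" "\<tau> \<subseteq> \<sigma> \<Longrightarrow> \<tau> \<noteq> {} \<Longrightarrow> \<tau> \<in> K"
  using assms unfolding abs_complex_def by blast+

lemma finite_Union_complex: "finite K \<Longrightarrow> abs_complex K \<Longrightarrow> finite (\<Union>K)"
  by (auto simp: abs_complex_def)

lemma continuous_on_coord: "continuous_on S (\<lambda>x::'v \<Rightarrow> real. x i)"
  by (rule continuous_on_subset[OF continuous_on_product_coordinates]) simp

lemma continuous_on_snd_coord: "continuous_on S (\<lambda>p::'a::topological_space \<times> ('v \<Rightarrow> real). snd p i)"
  by (rule continuous_on_product_then_coordinatewise) (intro continuous_intros)

text \<open>The realization is a closed part of a product of intervals and points, compact by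
  Tychonoff. The condition on \<open>supp x\<close> is not visibly closed, but given total mass 1 it
  amounts to vanishing off some \<sigma> in the finite complex, because a nonempty subset of
  \<sigma> is again a simplex.\<close>

lemma compact_realization:
  fixes K :: "'v set set"
  assumes K: "finite K" "abs_complex K"
  shows "compact (realization K)"
proof -
  define V where "V = \<Union>K"
  have V: "finite V" "\<Union>K \<subseteq> V" using finite_Union_complex K by (auto simp: V_def)
  define B where "B = (\<lambda>v. if v \<in> V then {0..1::real} else {0})"
  define C where "C = (\<Pi>\<^sub>E v\<in>UNIV. B v)"
  \<comment> \<open>\<open>F \<sigma>\<close> is the closed set of functions vanishing off
    \<sigma>.\<close>
  define F where "F = (\<lambda>\<sigma>. \<Inter>v\<in>-\<sigma>. {x::'v \<Rightarrow> real. x v = 0})"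
  have "compactin (product_topology (\<lambda>_. euclidean) UNIV) C"
    unfolding C_def compactin_PiE by (auto simp: B_def)
  then have "compact C" by (simp add: euclidean_product_topology)
  have "closed ((\<Union>\<sigma>\<in>K. F \<sigma>) \<inter> {x. sum x V = 1})"
    unfolding F_def
    by (intro closed_Int closed_UN closed_INT closed_Collect_eq continuous_on_sum continuous_on_coord
      continuous_on_const K ballI)
  then have "compact (C \<inter> ((\<Union>\<sigma>\<in>K. F \<sigma>) \<inter> {x. sum x V = 1}))"
    by (rule compact_Int_closed[OF \<open>compact C\<close>])
  also have "C \<inter> ((\<Union>\<sigma>\<in>K. F \<sigma>) \<inter> {x. sum x V = 1}) = realization K" (is "?L = _")
  proof (intro equalityI subsetI)
    fix x assume x: "x \<in> ?L"
    then obtain \<sigma> where s: "\<sigma> \<in> K" "\<forall>v. v \<notin> \<sigma> \<longrightarrow> x v = 0" and 1: "sum x V = 1"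
      by (auto simp: F_def)
    have nn: "0 \<le> x v" for v
      using x by (auto simp: C_def B_def PiE_iff dest!: spec[of _ v] split: if_splits)
    have "supp x \<noteq> {}"
    proof
      assume "supp x = {}"
      then have "x = (\<lambda>_. 0)" by (auto simp: supp_def)
      then show False using 1 by simp
    qed
    moreover have "supp x \<subseteq> \<sigma>" using s by (auto simp: supp_def)
    ultimately have "supp x \<in> K" using abs_complexD(3)[OF K(2) s(1)] by blast
    then show "x \<in> realization K" using nn 1 realization_iff[OF V, of x] by blast
  next
    fix x assume x: "x \<in> realization K"
    then have "x v \<in> B v" for v
      using realization_le_1[OF V x, of v] realization_iff[OF V, of x] V(2) by (auto simp: B_def supp_def)
    moreover have "x \<in> F (supp x)" by (auto simp: F_def supp_def)
    ultimately show "x \<in> ?L"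
      using x realization_iff[OF V, of x] by (auto simp: C_def)
  qed
  finally show ?thesis .
qed

lemma Hausdorff_euclidean_fun: "Hausdorff_space (top_of_set (S :: ('v \<Rightarrow> real) set))"
proof -
  have "Hausdorff_space (product_topology (\<lambda>_::'v. euclideanreal) UNIV)"
    by (simp add: Hausdorff_space_product_topology)
  then show ?thesis
    by (simp add: euclidean_product_topology Hausdorff_space_subtopology)
qed

text \<open>At a zero of \<open>m\<close> the product is squeezed by \<bar>\<open>m\<close>\<bar>,
  so \<open>h\<close> may jump there. This handles the maps below whose formulas divide by a mass
  that can vanish.\<close>

lemma continuous_on_mult_bounded:
  fixes m h :: "'a::topological_space \<Rightarrow> real"
  assumes m: "continuous_on S m" and h: "continuous_on {x\<in>S. m x \<noteq> 0} h"
    and b: "\<And>x. x \<in> S \<Longrightarrow> m x \<noteq> 0 \<Longrightarrow> \<bar>h x\<bar> \<le> 1"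
  shows "continuous_on S (\<lambda>x. m x * h x)"
  unfolding continuous_on_def
proof
  fix x assume x: "x \<in> S"
  have mx: "(m \<longlongrightarrow> m x) (at x within S)" using m x by (auto simp: continuous_on_def)
  show "((\<lambda>x. m x * h x) \<longlongrightarrow> m x * h x) (at x within S)"
  proof (cases "m x = 0")
    case True
    have "((\<lambda>x. m x * h x) \<longlongrightarrow> 0) (at x within S)"
    proof (rule Lim_null_comparison)
      show "\<forall>\<^sub>F y in at x within S. norm (m y * h y) \<le> \<bar>m y\<bar>"
        unfolding eventually_at_filter
        by (rule always_eventually) (use b in \<open>force simp: abs_mult intro: mult_left_le\<close>)
      show "((\<lambda>y. \<bar>m y\<bar>) \<longlongrightarrow> 0) (at x within S)" using mx True by (simp add: tendsto_rabs_zero)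
    qed
    then show ?thesis using True by simp
  next
    case False
    have "openin (top_of_set S) (S \<inter> m -` (-{0}))"
      using m by (rule continuous_openin_preimage_gen) auto
    then obtain U where U: "open U" "S \<inter> m -` (-{0}) = S \<inter> U" by (auto simp: openin_open)
    have eq: "{y\<in>S. m y \<noteq> 0} = S \<inter> U" using U by auto
    then have "x \<in> U" using False x by auto
    have "at x within S = at x within (S \<inter> U)"
      using \<open>x \<in> U\<close> U(1) by (subst at_within_nhd[of x U S "S \<inter> U"]) auto
    moreover have "(h \<longlongrightarrow> h x) (at x within (S \<inter> U))"
      using h \<open>x \<in> U\<close> x unfolding eq continuous_on_def by blast
    ultimately show ?thesis using mx by (auto intro: tendsto_mult)
  qed
qed

section \<open>Filtrations\<close>

text \<open>Complex, stage space and stage map grow together. The parameter is a set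
  \<open>Cr\<close> of simplices and not a Morse function, since the function is read off only after
  the whole filtration is known.\<close>

inductive collapsed ::
    "'v set set \<Rightarrow> 'v set set \<Rightarrow> ('v \<Rightarrow> real) topology \<Rightarrow> (('v \<Rightarrow> real) \<Rightarrow> ('v \<Rightarrow> real)) \<Rightarrow> bool"
  for Cr where
  empty: "collapsed Cr {} (top_of_set {}) id"
| crit: "\<lbrakk>collapsed Cr L Y p; abs_complex L'; L' = insert \<sigma> L; \<sigma> \<notin> L; \<sigma> \<in> Cr\<rbrakk> \<Longrightarrow>
    collapsed Cr L' (pushout_space (top_of_set (realization L')) (realization L) p Y)
      (pushout_map (realization L) p)"
| pair: "\<lbrakk>collapsed Cr L Y p; abs_complex L'; L' = insert \<sigma> (insert \<tau> L); \<sigma> \<notin> L; \<tau> \<notin> L;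
    \<sigma> \<notin> Cr; \<tau> \<notin> Cr; \<sigma> \<prec>\<^sub>s \<tau>; free_face L' \<sigma> \<tau>;
    strong_deformation_retraction (realization L') (realization L) \<rho>;
    \<rho> ` realization {\<mu>. \<mu> \<noteq> {} \<and> \<mu> \<subseteq> \<tau>} = realization {\<mu>. \<mu> \<noteq> {} \<and> \<mu> \<subset> \<tau> \<and> \<mu> \<noteq> \<sigma>}\<rbrakk> \<Longrightarrow>
    collapsed Cr L' Y (p \<circ> \<rho>)"

lemma collapsed_abs_complex: "collapsed Cr L Y p \<Longrightarrow> abs_complex L"
  by (induction rule: collapsed.induct) (assumption | simp add: abs_complex_def)+

lemma collapsed_topspace: "collapsed Cr L Y p \<Longrightarrow> topspace Y \<subseteq> realization L"
proof (induction rule: collapsed.induct)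
  case (crit L Y p L' \<sigma>)
  then show ?case
    using topspace_pushout_subset[of "top_of_set (realization L')" "realization L" p Y]
      realization_mono[of L L'] by auto
next
  case (pair L Y p L' \<sigma> \<tau> \<rho>)
  then show ?case using realization_mono[of L L'] by auto
qed simp

lemma collapsed_continuous: "collapsed Cr L Y p \<Longrightarrow> continuous_map (top_of_set (realization L)) Y p"
proof (induction rule: collapsed.induct)
  case (crit L Y p L' \<sigma>)
  have sub: "realization L \<subseteq> realization L'" using crit by (intro realization_mono) auto
  then have eq: "subtopology (top_of_set (realization L')) (realization L) = top_of_set (realization L)"
    by (simp add: subtopology_subtopology Int_absorb1)
  show ?case
    by (rule pushout_space_universal(2))
      (use sub eq crit collapsed_topspace[OF crit(1)] in auto)
next
  case (pair L Y p L' \<sigma> \<tau> \<rho>)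
  have "continuous_map (top_of_set (realization L')) (top_of_set (realization L)) \<rho>"
    using pair(10) by (auto simp: strong_deformation_retraction_def retraction_def)
  then show ?case using pair.IH by (rule continuous_map_compose)
qed simp

section \<open>From inductive stages to an indexed filtration\<close>

text \<open>The step condition of \<open>internal_core_choice\<close>, with \<open>Cr\<close>
  standing for the critical simplices and the facet relation outside \<open>Cr\<close> standing for
  a matched pair.\<close>

definition elementary_step :: "'v set set \<Rightarrow> 'v set set \<Rightarrow> 'v set set \<Rightarrow> (('v \<Rightarrow> real) \<Rightarrow> ('v \<Rightarrow> real)) \<Rightarrow> bool" where
  "elementary_step Cr L L' \<rho> \<longleftrightarrow> L \<subset> L' \<and>
    ((\<exists>\<sigma>\<in>Cr. L' - L = {\<sigma>}) \<or>
     (\<exists>\<sigma> \<tau>. \<sigma> \<notin> Cr \<and> \<tau> \<notin> Cr \<and> \<sigma> \<prec>\<^sub>s \<tau> \<and> L' - L = {\<sigma>, \<tau>} \<and> free_face L' \<sigma> \<tau> \<and>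
      strong_deformation_retraction (realization L') (realization L) \<rho> \<and>
      \<rho> ` realization {\<mu>. \<mu> \<noteq> {} \<and> \<mu> \<subseteq> \<tau>} = realization {\<mu>. \<mu> \<noteq> {} \<and> \<mu> \<subset> \<tau> \<and> \<mu> \<noteq> \<sigma>}))"

lemma collapse_stage_cong:
  assumes "\<And>i. i \<le> j \<Longrightarrow> L i = L' i" "\<And>i. i < j \<Longrightarrow> \<rho> i = \<rho>' i"
  shows "collapse_stage L \<rho> j = collapse_stage L' \<rho>' j"
  using assms by (induction j) (simp_all add: Let_def cong: if_cong split: prod.split)

text \<open>Each rule appends one entry at \<open>Suc m\<close>; by
  \<open>collapse_stage_cong\<close> this does not disturb the earlier stages.\<close>

lemma collapsed_imp_filtration:
  assumes "collapsed Cr K Y p"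
  shows "\<exists>m L \<rho>. L 0 = {} \<and> L m = K \<and> (\<forall>j\<le>m. abs_complex (L j)) \<and>
    (\<forall>j<m. elementary_step Cr (L j) (L (Suc j)) (\<rho> j)) \<and> collapse_stage L \<rho> m = (Y, p)"
  using assms
proof (induction rule: collapsed.induct)
  case empty
  show ?case
    by (rule exI[of _ 0], rule exI[of _ "\<lambda>_. {}"]) (simp add: abs_complex_def id_def)
next
  case (crit K Y p K' \<sigma>)
  then obtain m L \<rho> where H: "L 0 = {}" "L m = K" "\<And>j. j \<le> m \<Longrightarrow> abs_complex (L j)"
    "\<And>j. j < m \<Longrightarrow> elementary_step Cr (L j) (L (Suc j)) (\<rho> j)" "collapse_stage L \<rho> m = (Y, p)"
    by blast
  let ?L = "L(Suc m := K')"
  have diff: "?L (Suc m) - ?L m = {\<sigma>}" using crit H by auto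
  have "collapse_stage ?L \<rho> m = (Y, p)"
    using H(5) collapse_stage_cong[of m ?L L \<rho> \<rho>] by simp
  then have "collapse_stage ?L \<rho> (Suc m) =
    (pushout_space (top_of_set (realization K')) (realization K) p Y, pushout_map (realization K) p)"
    using diff H(2) by (auto simp: Let_def)
  moreover have "elementary_step Cr (?L j) (?L (Suc j)) (\<rho> j)" if "j < Suc m" for j
  proof (cases "j = m")
    case True
    then show ?thesis using crit diff H(2) by (auto simp: elementary_step_def)
  next
    case False
    then show ?thesis using H(4)[of j] that by simp
  qed
  moreover have "abs_complex (?L j)" if "j \<le> Suc m" for j
    using that crit H(3)[of j] by (cases "j = Suc m") auto
  moreover have "?L 0 = {}" "?L (Suc m) = K'" using H(1) by simp_all
  ultimately show ?case by blast
next
  case (pair K Y p K' \<sigma> \<tau> \<rho>')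
  then obtain m L \<rho> where H: "L 0 = {}" "L m = K" "\<And>j. j \<le> m \<Longrightarrow> abs_complex (L j)"
    "\<And>j. j < m \<Longrightarrow> elementary_step Cr (L j) (L (Suc j)) (\<rho> j)" "collapse_stage L \<rho> m = (Y, p)"
    by blast
  let ?L = "L(Suc m := K')" and ?\<rho> = "\<rho>(m := \<rho>')"
  have diff: "?L (Suc m) - ?L m = {\<sigma>, \<tau>}" using pair H by auto
  \<comment> \<open>\<open>collapse_stage\<close> recognises a critical step by its single new
    simplex, so two distinct new simplices are needed to reach the branch of a collapse.\<close>
  have "\<sigma> \<noteq> \<tau>" using pair(8) by (auto simp: facet_of_def)
  then have nosing: "\<not> (\<exists>\<mu>. ?L (Suc m) - ?L m = {\<mu>})" unfolding diff by auto
  have "collapse_stage ?L ?\<rho> m = (Y, p)"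
    using H(5) collapse_stage_cong[of m ?L L ?\<rho> \<rho>] by simp
  then have "collapse_stage ?L ?\<rho> (Suc m) = (Y, p \<circ> \<rho>')"
    using nosing by (auto simp: Let_def)
  moreover have "elementary_step Cr (?L j) (?L (Suc j)) (?\<rho> j)" if "j < Suc m" for j
  proof (cases "j = m")
    case True
    then show ?thesis using pair diff H(2) unfolding elementary_step_def by auto
  next
    case False
    then show ?thesis using H(4)[of j] that by simp
  qed
  moreover have "abs_complex (?L j)" if "j \<le> Suc m" for j
    using that pair H(3)[of j] by (cases "j = Suc m") auto
  moreover have "?L 0 = {}" "?L (Suc m) = K'" using H(1) by simp_all
  ultimately show ?case by blast
qed

section \<open>A discrete Morse function from a filtration\<close>

lemma filtration_morse_function:
  fixes K :: "'v set set"
  assumes L: "L 0 = {}" "L m = K" and sub: "\<And>j. j \<le> m \<Longrightarrow> abs_complex (L j)"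
    and step: "\<And>j. j < m \<Longrightarrow> elementary_step Cr (L j) (L (Suc j)) (\<rho> j)"
    and Cr: "Cr \<subseteq> K"
  shows "\<exists>f. discrete_morse K f \<and> critical_simplices K f = Cr \<and> internal_core_choice K f m L \<rho>"
proof -
  \<comment> \<open>The index of the first stage containing a simplex is monotone under faces and constant exactly on
    the steps, so a facet relation violates strict monotonicity only inside a matched pair.\<close>
  define h where "h \<sigma> = (LEAST j. \<sigma> \<in> L j)" for \<sigma>
  define f where "f \<sigma> = real (h \<sigma>)" for \<sigma>
  have mono: "L i \<subseteq> L j" if "i \<le> j" "j \<le> m" for i j
    using that
  proof (induction j)
    case (Suc j)
    then show ?case using step[of j] by (cases "i = Suc j") (auto simp: elementary_step_def)
  qed simp
  have hm: "h \<sigma> \<le> m" if "\<sigma> \<in> K" for \<sigma>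
    unfolding h_def using that L by (auto intro: Least_le)
  have hL: "\<sigma> \<in> L j \<longleftrightarrow> h \<sigma> \<le> j" if "\<sigma> \<in> K" "j \<le> m" for \<sigma> j
  proof
    assume "h \<sigma> \<le> j"
    moreover have "\<sigma> \<in> L (h \<sigma>)" unfolding h_def using that L(2) LeastI by metis
    ultimately show "\<sigma> \<in> L j" using mono that by blast
  qed (auto simp: h_def intro: Least_le)
  have LK: "L j \<subseteq> K" if "j \<le> m" for j using mono[of j m] that L by auto
  have dif: "\<sigma> \<in> L (Suc j) - L j \<longleftrightarrow> \<sigma> \<in> K \<and> h \<sigma> = Suc j" if "j < m" for \<sigma> j
    using hL[of \<sigma> j] hL[of \<sigma> "Suc j"] that LK[of "Suc j"] by auto
  have face: "h \<sigma> \<le> h \<tau>" if "\<sigma> \<prec>\<^sub>s \<tau>" "\<sigma> \<in> K" "\<tau> \<in> K" for \<sigma> \<tau>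
  proof -
    have "\<tau> \<in> L (h \<tau>)" "\<sigma> \<noteq> {}"
      using hL[of \<tau> "h \<tau>"] that hm[of \<tau>] abs_complexD(2)[of K \<sigma>] sub[of m] L by auto
    then have "\<sigma> \<in> L (h \<tau>)" using abs_complexD(3)[OF sub[OF hm]] that by (auto simp: facet_of_def)
    then show ?thesis using hL that hm by blast
  qed
  \<comment> \<open>Since \<open>L 0\<close> is empty, no index is 0, and index \<open>Suc j\<close>
    names the step from \<open>L j\<close> to \<open>L (Suc j)\<close>.\<close>
  have h0: "\<exists>j<m. h \<sigma> = Suc j" if "\<sigma> \<in> K" for \<sigma>
    using hL[of \<sigma> 0] hm[of \<sigma>] that L(1) by (cases "h \<sigma>") auto
  have ms: "morse_set K f \<sigma> = {\<tau>\<in>K. h \<tau> = h \<sigma> \<and> (\<sigma> \<prec>\<^sub>s \<tau> \<or> \<tau> \<prec>\<^sub>s \<sigma>)}" if "\<sigma> \<in> K" for \<sigma>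
    using that face by (fastforce simp: morse_set_def f_def)
  have not_self: "\<not> \<sigma> \<prec>\<^sub>s \<sigma>" for \<sigma> :: "'v set" by (simp add: facet_of_def)
  have same: "{\<tau>\<in>K. h \<tau> = Suc j} = L (Suc j) - L j" if "j < m" for j
    using dif that by blast
  have single: "morse_set K f \<sigma> = {}" if j: "j < m" and d: "L (Suc j) - L j = {\<sigma>}" for \<sigma> j
  proof -
    have "\<sigma> \<in> K" "h \<sigma> = Suc j" using dif[OF j, of \<sigma>] d by auto
    then have "morse_set K f \<sigma> \<subseteq> {\<tau> \<in> {\<sigma>}. \<sigma> \<prec>\<^sub>s \<tau> \<or> \<tau> \<prec>\<^sub>s \<sigma>}"
      using ms[of \<sigma>] same[OF j] d by auto
    then show ?thesis using not_self by auto
  qed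
  have double: "\<sigma> \<in> K \<and> \<tau> \<in> K \<and> morse_set K f \<sigma> = {\<tau>} \<and> morse_set K f \<tau> = {\<sigma>}"
    if j: "j < m" and d: "L (Suc j) - L j = {\<sigma>, \<tau>}" and p: "\<sigma> \<prec>\<^sub>s \<tau>" for \<sigma> \<tau> j
  proof -
    have K: "\<sigma> \<in> K" "h \<sigma> = Suc j" "\<tau> \<in> K" "h \<tau> = Suc j"
      using dif[OF j, of \<sigma>] dif[OF j, of \<tau>] d by auto
    have "morse_set K f \<sigma> = {\<mu> \<in> {\<sigma>,\<tau>}. \<sigma> \<prec>\<^sub>s \<mu> \<or> \<mu> \<prec>\<^sub>s \<sigma>}"
      "morse_set K f \<tau> = {\<mu> \<in> {\<sigma>,\<tau>}. \<tau> \<prec>\<^sub>s \<mu> \<or> \<mu> \<prec>\<^sub>s \<tau>}"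
      using ms[OF K(1)] ms[OF K(3)] same[OF j] d K by auto
    moreover have "{\<mu> \<in> {\<sigma>,\<tau>}. \<sigma> \<prec>\<^sub>s \<mu> \<or> \<mu> \<prec>\<^sub>s \<sigma>} = {\<tau>}"
      "{\<mu> \<in> {\<sigma>,\<tau>}. \<tau> \<prec>\<^sub>s \<mu> \<or> \<mu> \<prec>\<^sub>s \<tau>} = {\<sigma>}"
      by (auto simp: p not_self)
    ultimately show ?thesis using K by simp
  qed
  have crit_iff: "card (morse_set K f \<sigma>) \<le> 1 \<and> finite (morse_set K f \<sigma>) \<and>
      (morse_set K f \<sigma> = {} \<longleftrightarrow> \<sigma> \<in> Cr)" if s: "\<sigma> \<in> K" for \<sigma>
  proof -
    obtain j where j: "j < m" "h \<sigma> = Suc j" using h0[OF s] by blast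
    then have sd: "\<sigma> \<in> L (Suc j) - L j" using dif[OF j(1)] s by blast
    show ?thesis
      using step[OF j(1)] unfolding elementary_step_def
    proof (elim conjE disjE bexE exE, goal_cases)
      case (1 \<mu>)
      then have "\<mu> = \<sigma>" using sd by auto
      then show ?case using 1 single[OF j(1), of \<sigma>] by auto
    next
      case (2 \<mu> \<nu>)
      then have "\<sigma> = \<mu> \<or> \<sigma> = \<nu>" using sd by auto
      then show ?case using double[OF j(1), of \<mu> \<nu>] 2 by auto
    qed
  qed
  have crit_eq: "critical_simplices K f = Cr"
    using crit_iff Cr unfolding critical_simplices_def by blast
  have "(\<exists>\<sigma>\<in>critical_simplices K f. L (Suc j) - L j = {\<sigma>}) \<or>
        (\<exists>\<sigma> \<tau>. matched_pair K f \<sigma> \<tau> \<and> L (Suc j) - L j = {\<sigma>, \<tau>} \<and>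
           free_face (L (Suc j)) \<sigma> \<tau> \<and>
           strong_deformation_retraction (realization (L (Suc j))) (realization (L j)) (\<rho> j) \<and>
           \<rho> j ` realization {\<mu>. \<mu> \<noteq> {} \<and> \<mu> \<subseteq> \<tau>} =
             realization {\<mu>. \<mu> \<noteq> {} \<and> \<mu> \<subset> \<tau> \<and> \<mu> \<noteq> \<sigma>})" if j: "j < m" for j
    using step[OF j] unfolding elementary_step_def crit_eq
  proof (elim conjE disjE exE, goal_cases)
    case 1
    show ?case by (rule disjI1) (fact 1)
  next
    case (2 \<sigma> \<tau>)
    have mp: "matched_pair K f \<sigma> \<tau>"
      using double[OF j, of \<sigma> \<tau>] 2(4,5) by (simp add: matched_pair_def)
    show ?case
      by (rule disjI2, rule exI[of _ \<sigma>], rule exI[of _ \<tau>], intro conjI mp 2)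
  qed
  moreover have "L j \<subset> L (Suc j)" if "j < m" for j
    using step[OF that] unfolding elementary_step_def by (elim conjE)
  ultimately have "internal_core_choice K f m L \<rho>"
    unfolding internal_core_choice_def subcomplex_def by (intro conjI allI impI L sub LK)
  moreover have "discrete_morse K f" using crit_iff by (auto simp: discrete_morse_def)
  ultimately show ?thesis using crit_eq by blast
qed

section \<open>Pushouts along a support-preserving pseudo-isotopy\<close>

text \<open>Glue \<phi> on the old space to \<open>C\<close> on \<open>X - A\<close>. Continuity is
  immediate from the quotient topology. \<open>C\<close> may fail to be injective on
  \<open>A\<close>, so openness rests instead on \<open>C\<close> being a quotient map, as a
  continuous surjection from a compact space to a Hausdorff space.\<close>

lemma pushout_homeomorphic_map:
  fixes X A :: "('v \<Rightarrow> real) set"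
  assumes "compact X" and A: "A \<subseteq> X" and C: "continuous_on X C" "C ` X = X" "C ` A \<subseteq> A"
    and bij: "bij_betw C (X - A) (X - A)"
    and \<phi>: "homeomorphic_map Y Z \<phi>" and p: "p ` A \<subseteq> topspace Y" and q: "q ` A \<subseteq> topspace Z"
    and com: "\<And>x. x \<in> A \<Longrightarrow> \<phi> (p x) = q (C x)"
    and dY: "topspace Y \<inter> (X - A) = {}" and dZ: "topspace Z \<inter> (X - A) = {}"
  shows "\<exists>\<Phi>. homeomorphic_map (pushout_space (top_of_set X) A p Y) (pushout_space (top_of_set X) A q Z) \<Phi> \<and>
    (\<forall>x\<in>X. \<Phi> (pushout_map A p x) = pushout_map A q (C x))"
proof -
  let ?P = "pushout_space (top_of_set X) A p Y" and ?Q = "pushout_space (top_of_set X) A q Z"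
  have tP: "topspace ?P = topspace Y \<union> (X - A)"
    by (subst topspace_pushout_space) (use p in auto)
  have tQ: "topspace ?Q = topspace Z \<union> (X - A)"
    by (subst topspace_pushout_space) (use q in auto)
  define \<Phi> where "\<Phi> z = (if z \<in> topspace Y then \<phi> z else C z)" for z
  have \<phi>Y: "\<phi> ` topspace Y = topspace Z" "inj_on \<phi> (topspace Y)" "continuous_map Y Z \<phi>" "open_map Y Z \<phi>"
    using \<phi> by (auto simp: homeomorphic_eq_everything_map)
  have \<Phi>Y: "\<Phi> z = \<phi> z" if "z \<in> topspace Y" for z using that by (simp add: \<Phi>_def)
  have \<Phi>C: "\<Phi> z = C z" if "z \<in> X - A" for z using that dY by (auto simp: \<Phi>_def)
  have CXA: "C ` (X - A) = X - A" "inj_on C (X - A)" using bij by (auto simp: bij_betw_def)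
  have com': "\<Phi> (pushout_map A p x) = pushout_map A q (C x)" if "x \<in> X" for x
  proof (cases "x \<in> A")
    case True
    then show ?thesis using com p C(3) by (auto simp: pushout_map_def \<Phi>Y image_subset_iff)
  next
    case False
    then have "C x \<in> X - A" using CXA that by blast
    then show ?thesis using False that by (auto simp: pushout_map_def \<Phi>C)
  qed
  have img: "\<Phi> ` topspace ?P = topspace ?Q"
  proof -
    have "\<Phi> ` topspace Y = topspace Z" using \<Phi>Y \<phi>Y(1) by simp
    moreover have "\<Phi> ` (X - A) = X - A" using \<Phi>C CXA(1) by simp
    ultimately show ?thesis unfolding tP tQ by (simp add: image_Un)
  qed
  have inj: "inj_on \<Phi> (topspace ?P)"
  proof -
    have "inj_on \<Phi> (topspace Y)" using \<phi>Y(2) \<Phi>Y by (simp cong: inj_on_cong)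
    moreover have "inj_on \<Phi> (X - A)" using CXA(2) \<Phi>C inj_on_cong[of "X - A" \<Phi> C] by blast
    moreover have "\<Phi> y \<noteq> \<Phi> x" if "y \<in> topspace Y" "x \<in> X - A" for x y
    proof -
      have "\<Phi> y \<in> topspace Z" using \<Phi>Y[OF that(1)] \<phi>Y(1) that(1) by auto
      moreover have "\<Phi> x \<in> X - A" using \<Phi>C[OF that(2)] CXA(1) that(2) by blast
      ultimately show ?thesis using dZ by auto
    qed
    ultimately show ?thesis unfolding tP inj_on_def by (metis Un_iff)
  qed
  have pm: "pushout_map A p x \<in> topspace ?P" if "x \<in> X" for x
    using that p tP by (auto simp: pushout_map_def)
  have quot: "quotient_map (top_of_set X) (top_of_set X) C"
    by (rule continuous_imp_quotient_map)
      (use C assms(1) in \<open>auto simp: Hausdorff_euclidean_fun compact_space_subtopology\<close>)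
  have "continuous_map ?P ?Q \<Phi>"
    unfolding continuous_map_def
  proof (intro conjI allI impI)
    show "\<Phi> \<in> topspace ?P \<rightarrow> topspace ?Q" using img by blast
    fix U assume U: "openin ?Q U"
    let ?W = "{z \<in> topspace ?P. \<Phi> z \<in> U}"
    have "topspace Y \<inter> ?W = {y \<in> topspace Y. \<phi> y \<in> topspace Z \<inter> U}"
      using tP \<Phi>Y \<phi>Y(1) by auto
    moreover have "{x \<in> X. pushout_map A p x \<in> ?W} =
        {x \<in> X. C x \<in> {x \<in> X. pushout_map A q x \<in> U}}"
      using pm com' C(2) by auto
    moreover have "openin (top_of_set X) {x \<in> topspace (top_of_set X). C x \<in> {x \<in> X. pushout_map A q x \<in> U}}"
      using U C by (intro openin_continuous_map_preimage[where Y = "top_of_set X"])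
        (auto simp: openin_pushout_space)
    moreover have "openin Y {y \<in> topspace Y. \<phi> y \<in> topspace Z \<inter> U}"
      using U by (intro openin_continuous_map_preimage[OF \<phi>Y(3)]) (auto simp: openin_pushout_space)
    ultimately show "openin ?P ?W" unfolding openin_pushout_space using tP by auto
  qed
  moreover have "open_map ?P ?Q \<Phi>"
    unfolding open_map_def
  proof (intro allI impI)
    fix U assume U: "openin ?P U"
    have UP: "U \<subseteq> topspace ?P" using U by (rule openin_subset)
    have "topspace Z \<inter> \<Phi> ` U = \<phi> ` (topspace Y \<inter> U)"
    proof -
      have "\<phi> ` (topspace Y \<inter> U) \<subseteq> topspace Z \<inter> \<Phi> ` U" using \<Phi>Y \<phi>Y(1) by force
      moreover have "z \<in> \<phi> ` (topspace Y \<inter> U)" if z: "z \<in> topspace Z" "z = \<Phi> w" "w \<in> U" for z w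
      proof -
        have "w \<notin> X - A"
        proof
          assume w: "w \<in> X - A"
          then have "z \<in> X - A" using \<Phi>C[OF w] CXA(1) z(2) by blast
          then show False using z(1) dZ by blast
        qed
        then have "w \<in> topspace Y" using z(3) UP tP by blast
        then show ?thesis using z \<Phi>Y by auto
      qed
      ultimately show ?thesis by blast
    qed
    moreover have "openin Z (\<phi> ` (topspace Y \<inter> U))"
      using \<phi>Y(4) U by (auto simp: open_map_def openin_pushout_space)
    \<comment> \<open>Openness may be tested on the preimage under \<open>C\<close>; by injectivity
      of \<Phi> this is the set of points that \<open>pushout_map A p\<close> sends into
      \<open>U\<close>.\<close>
    moreover have "openin (top_of_set X) {x \<in> X. pushout_map A q x \<in> \<Phi> ` U}"
    proof -
      let ?V = "{x \<in> X. pushout_map A q x \<in> \<Phi> ` U}"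
      have "{x \<in> topspace (top_of_set X). C x \<in> ?V} = {x \<in> X. pushout_map A p x \<in> U}"
      proof -
        have "\<Phi> (pushout_map A p x) \<in> \<Phi> ` U \<longleftrightarrow> pushout_map A p x \<in> U" if "x \<in> X" for x
          by (rule inj_on_image_mem_iff[OF inj pm[OF that] UP])
        then show ?thesis using com' C(2) by auto
      qed
      then have "openin (top_of_set X) {x \<in> topspace (top_of_set X). C x \<in> ?V}"
        using U by (simp add: openin_pushout_space)
      moreover have "?V \<subseteq> topspace (top_of_set X)" by auto
      ultimately show ?thesis using quot unfolding quotient_map_def by blast
    qed
    moreover have "\<Phi> ` U \<subseteq> topspace Z \<union> (X - A)"
      using image_mono[OF UP, of \<Phi>] unfolding img tQ .
    ultimately show "openin ?Q (\<Phi> ` U)" unfolding openin_pushout_space by simp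
  qed
  ultimately have "homeomorphic_map ?P ?Q \<Phi>"
    by (rule bijective_open_imp_homeomorphic_map[OF _ _ img inj])
  then show ?thesis using com' by blast
qed

section \<open>Pseudo-isotopies and their end at time 0\<close>

text \<open>For positive \<open>t\<close> every open simplex is permuted; at \<open>t = 0\<close> a
  point may also drop to a face of its simplex, so injectivity can be lost there.\<close>

definition pseudo_isotopy :: "'v set set \<Rightarrow> (real \<Rightarrow> ('v \<Rightarrow> real) \<Rightarrow> ('v \<Rightarrow> real)) \<Rightarrow> bool" where
  "pseudo_isotopy K c \<longleftrightarrow> continuous_on ({0..1} \<times> realization K) (\<lambda>p. c (fst p) (snd p)) \<and>
    (\<forall>t\<in>{0..1}. \<forall>x\<in>realization K. c t x \<in> realization K \<and> supp (c t x) \<subseteq> supp x) \<and>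
    (\<forall>t\<in>{0<..1}. bij_betw (c t) (realization K) (realization K) \<and>
      (\<forall>x\<in>realization K. supp (c t x) = supp x))"

lemma pseudo_isotopyD:
  assumes "pseudo_isotopy K c" "t \<in> {0..1}" "x \<in> realization K"
  shows "c t x \<in> realization K" "supp (c t x) \<subseteq> supp x" "0 < t \<Longrightarrow> supp (c t x) = supp x"
  using assms by (auto simp: pseudo_isotopy_def)

lemma pseudo_isotopy_bij:
  assumes "pseudo_isotopy K c" "0 < t" "t \<le> 1"
  shows "bij_betw (c t) (realization K) (realization K)"
  using assms by (auto simp: pseudo_isotopy_def)

lemma pseudo_isotopy_compose:
  assumes c: "pseudo_isotopy K c" and "continuous_on T \<tau>" "continuous_on T f"
    and "\<And>p. p \<in> T \<Longrightarrow> \<tau> p \<in> {0..1} \<and> f p \<in> realization K"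
  shows "continuous_on T (\<lambda>p. c (\<tau> p) (f p))"
proof -
  have "continuous_on ({0..1} \<times> realization K) (\<lambda>p. c (fst p) (snd p))"
    using c by (simp add: pseudo_isotopy_def)
  then have "continuous_on T (\<lambda>p. (\<lambda>p. c (fst p) (snd p)) (\<tau> p, f p))"
    by (rule continuous_on_compose2) (use assms in \<open>auto intro!: continuous_intros\<close>)
  then show ?thesis by simp
qed

lemma closed_fun_singleton: "closed {z :: 'v \<Rightarrow> real}"
proof -
  have "{z} = (\<Inter>i. {x. x i = z i})" by (auto simp: fun_eq_iff)
  moreover have "closed (\<Inter>i. {x. x i = z i})"
    by (intro closed_INT ballI closed_Collect_eq continuous_on_coord continuous_on_const)
  ultimately show ?thesis by simp
qed

text \<open>For a fixed \<open>z\<close>, the times at which \<open>z\<close> has a preimage form a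
  compact set. It contains all of (0,1), hence also 0.\<close>

lemma pseudo_isotopy_0_surj:
  assumes K: "finite K" "abs_complex K" and c: "pseudo_isotopy K c"
  shows "c 0 ` realization K = realization K"
proof
  show "c 0 ` realization K \<subseteq> realization K" using pseudo_isotopyD(1)[OF c, of 0] by auto
  show "realization K \<subseteq> c 0 ` realization K"
  proof
    fix z assume z: "z \<in> realization K"
    let ?S = "{0..1::real} \<times> realization K"
    have cS: "compact ?S" by (intro compact_Times compact_realization K compact_Icc)
    let ?E = "?S \<inter> (\<lambda>p. c (fst p) (snd p)) -` {z}"
    have "closedin (top_of_set ?S) ?E"
      using c closed_fun_singleton by (intro continuous_closedin_preimage) (auto simp: pseudo_isotopy_def)
    then have "compact ?E" using cS closedin_compact by blast
    then have "compact (fst ` ?E)" by (rule compact_continuous_image[rotated]) (intro continuous_intros)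
    then have "closed (fst ` ?E)" by (rule compact_imp_closed)
    moreover have "{0<..<1} \<subseteq> fst ` ?E"
    proof
      fix t :: real assume t: "t \<in> {0<..<1}"
      then obtain x where "x \<in> realization K" "c t x = z"
        using z pseudo_isotopy_bij[OF c, of t] unfolding bij_betw_def by force
      then have "(t, x) \<in> ?E" using t by auto
      then show "t \<in> fst ` ?E" by force
    qed
    ultimately have "closure {0<..<1} \<subseteq> fst ` ?E" by (rule closure_minimal[rotated])
    then have "0 \<in> fst ` ?E" by (auto simp: closure_greaterThanLessThan)
    then show "z \<in> c 0 ` realization K" by auto
  qed
qed

section \<open>Extension over a cone\<close>

text \<open>For \<open>y u = 0\<close> this is the point at parameter \<open>t\<close> on the
  segment from \<open>y\<close> to the vertex \<open>u\<close>.\<close>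

definition join :: "'v \<Rightarrow> real \<Rightarrow> ('v \<Rightarrow> real) \<Rightarrow> ('v \<Rightarrow> real)" where
  "join u t y = (\<lambda>w. if w = u then t else (1 - t) * y w)"

text \<open>The radial projection from \<open>u\<close> to the opposite face. At the apex, where
  \<open>x u = 1\<close>, division by zero yields the zero function, which is not a point of the
  realization.\<close>

definition base :: "'v \<Rightarrow> ('v \<Rightarrow> real) \<Rightarrow> ('v \<Rightarrow> real)" where
  "base u x = (\<lambda>w. if w = u then 0 else x w / (1 - x u))"

text \<open>The height \<open>x u\<close> is kept and the base point is moved by \<open>c\<close>.
  The maximum makes the time positive as soon as \<open>x u\<close> is, while on the base, where
  \<open>x u = 0\<close>, the time is just \<open>s\<close>.\<close>

definition cone_ext :: "'v \<Rightarrow> (real \<Rightarrow> ('v \<Rightarrow> real) \<Rightarrow> ('v \<Rightarrow> real)) \<Rightarrow> real \<Rightarrow> ('v \<Rightarrow> real) \<Rightarrow> ('v \<Rightarrow> real)" where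
  "cone_ext u c s x = join u (x u) (c (max s (x u)) (base u x))"

lemma join_apply [simp]: "join u t y u = t" by (simp add: join_def)

lemma join_base: "x u \<noteq> 1 \<Longrightarrow> join u (x u) (base u x) = x"
  by (auto simp: join_def base_def fun_eq_iff)

lemma base_join: "t \<noteq> 1 \<Longrightarrow> y u = 0 \<Longrightarrow> base u (join u t y) = y"
  by (auto simp: join_def base_def fun_eq_iff)

lemma supp_join: "t \<noteq> 1 \<Longrightarrow> y u = 0 \<Longrightarrow> supp (join u t y) = (if t = 0 then {} else {u}) \<union> supp y"
  by (auto simp: join_def supp_def)

lemma supp_base: "x u \<noteq> 1 \<Longrightarrow> supp (base u x) = supp x - {u}"
  by (auto simp: base_def supp_def)

lemma join_0: "y u = 0 \<Longrightarrow> join u 0 y = y"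
  by (auto simp: join_def)

context
  fixes B :: "'v set set" and u :: 'v and V
  assumes V: "finite V" "\<Union>B \<subseteq> V" and u: "u \<in> V" and B: "abs_complex B"
begin

lemma realization_deletion_iff:
  "x \<in> realization (deletion B u) \<longleftrightarrow> x \<in> realization B \<and> x u = 0"
  by (auto simp: realization_def deletion_def supp_def)

lemma sum_join: "sum (join u t y) V = t + (1 - t) * (sum y V - y u)"
  using V u by (simp add: sum.remove[of V u] join_def sum_distrib_left)

lemma base_in:
  assumes x: "x \<in> realization B" and "x u \<noteq> 1"
  shows "base u x \<in> realization (deletion B u)"
proof -
  have x': "supp x \<in> B" "\<And>w. 0 \<le> x w" "sum x V = 1" using x realization_iff[OF V] by auto
  have lt: "x u < 1" using realization_le_1[OF V x, of u] assms(2) by simp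
  have "sum (base u x) V = (\<Sum>w\<in>V - {u}. x w) / (1 - x u)"
    using V u by (simp add: sum.remove[of V u] base_def sum_divide_distrib)
  also have "\<dots> = 1" using x'(3) V u lt by (simp add: sum.remove[of V u])
  finally have s: "sum (base u x) V = 1" .
  have "supp (base u x) \<noteq> {}"
  proof
    assume "supp (base u x) = {}"
    then have "base u x = (\<lambda>_. 0)" by (auto simp: supp_def)
    then show False using s by simp
  qed
  then have "supp (base u x) \<in> B"
    using abs_complexD(3)[OF B x'(1), of "supp (base u x)"] assms(2) by (auto simp: supp_base)
  then have "base u x \<in> realization B"
    unfolding realization_iff[OF V] using s x'(2) lt by (auto simp: base_def)
  then show ?thesis by (simp add: realization_deletion_iff base_def)
qed

lemma join_in:
  assumes "y \<in> realization (deletion B u)" "0 \<le> t" "t \<le> 1" "supp (join u t y) \<in> B"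
  shows "join u t y \<in> realization B"
proof -
  have y: "\<And>w. 0 \<le> y w" "sum y V = 1" "y u = 0"
    using assms(1) realization_iff[OF V] by (auto simp: realization_deletion_iff)
  show ?thesis unfolding realization_iff[OF V] sum_join using y assms by (auto simp: join_def)
qed

text \<open>All the mass sits at \<open>u\<close>, so the second argument of \<open>join\<close> is
  irrelevant. This makes the junk value of \<open>base\<close> at the apex harmless.\<close>

lemma apex:
  assumes "x \<in> realization B" "x u = 1"
  shows "x = join u 1 y"
proof -
  have x: "\<And>w. 0 \<le> x w" "sum x V = 1" "supp x \<in> B" using assms(1) realization_iff[OF V] by auto
  have "sum x (V - {u}) = 0" using x(2) assms(2) V u by (simp add: sum.remove[of V u])
  then have "\<forall>w\<in>V - {u}. x w = 0" using x(1) V by (simp add: sum_nonneg_eq_0_iff)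
  moreover have "x w = 0" if "w \<notin> V" for w using that x(3) V(2) by (auto simp: supp_def)
  ultimately show ?thesis using assms(2) by (auto simp: join_def fun_eq_iff)
qed

context
  fixes c
  assumes c: "pseudo_isotopy (deletion B u) c"
begin

lemma cone_ext_apply [simp]: "cone_ext u c s x u = x u"
  by (simp add: cone_ext_def)

lemma cone_ext_in:
  assumes s: "0 \<le> s" "s \<le> 1" and x: "x \<in> realization B"
  shows "cone_ext u c s x \<in> realization B \<and> supp (cone_ext u c s x) \<subseteq> supp x \<and>
    (0 < max s (x u) \<longrightarrow> supp (cone_ext u c s x) = supp x)"
proof (cases "x u = 1")
  case True
  then have "cone_ext u c s x = x" using apex[OF x] unfolding cone_ext_def by metis
  then show ?thesis using x by simp
next
  case False
  have x': "supp x \<in> B" "\<And>w. 0 \<le> x w" using x realization_iff[OF V] by auto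
  have xu: "0 \<le> x u" "x u < 1" using x'(2) realization_le_1[OF V x, of u] False by (auto simp: less_le)
  let ?y = "c (max s (x u)) (base u x)"
  have m: "max s (x u) \<in> {0..1}" using s xu by auto
  note y = pseudo_isotopyD[OF c m base_in[OF x False]]
  have yu: "?y u = 0" using y(1) by (simp add: realization_deletion_iff)
  have sc: "supp (cone_ext u c s x) = (if x u = 0 then {} else {u}) \<union> supp ?y"
    unfolding cone_ext_def using False yu by (rule supp_join)
  have sub: "supp (cone_ext u c s x) \<subseteq> supp x"
    unfolding sc using y(2) False by (auto simp: supp_base) (auto simp: supp_def)
  have eq: "supp (cone_ext u c s x) = supp x" if "0 < max s (x u)"
    unfolding sc y(3)[OF that] supp_base[of x u, OF False] by (auto simp: supp_def)
  have "supp ?y \<noteq> {}"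
    using y(1) abs_complexD(2)[OF B] realization_iff[OF V] by (auto simp: realization_deletion_iff)
  then have "supp (cone_ext u c s x) \<in> B"
    using abs_complexD(3)[OF B x'(1) sub] unfolding sc by blast
  then have "cone_ext u c s x \<in> realization B"
    unfolding cone_ext_def using xu by (intro join_in y) auto
  then show ?thesis using sub eq by blast
qed

lemma cone_ext_base:
  assumes "x \<in> realization B" "x u \<noteq> 1" "0 \<le> s" "s \<le> 1"
  shows "base u (cone_ext u c s x) = c (max s (x u)) (base u x)"
proof -
  have "max s (x u) \<in> {0..1}"
    using assms realization_le_1[OF V assms(1), of u] by auto
  then have "c (max s (x u)) (base u x) u = 0"
    using pseudo_isotopyD(1)[OF c _ base_in[OF assms(1,2)]] by (auto simp: realization_deletion_iff)
  then show ?thesis unfolding cone_ext_def using assms(2) by (rule base_join[rotated])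
qed

text \<open>The height at \<open>u\<close> is preserved, so on each slice of constant height below 1
  the time is constant and positive on \<open>S\<close>, and the map is a bijection of bases. For
  \<open>s = 0\<close> the set \<open>S\<close> is the open star of \<open>u\<close>, for
  \<open>s > 0\<close> the whole realization.\<close>

lemma cone_ext_bij:
  assumes s: "0 \<le> s" "s \<le> 1"
  defines "S \<equiv> {x \<in> realization B. 0 < max s (x u)}"
  shows "bij_betw (cone_ext u c s) S S"
proof -
  have ran: "max s (x u) \<in> {0..1}" if "x \<in> realization B" for x
    using s that realization_le_1[OF V that, of u] by auto
  have "inj_on (cone_ext u c s) S"
  proof
    fix x x' assume x: "x \<in> S" and x': "x' \<in> S" and eq: "cone_ext u c s x = cone_ext u c s x'"
    have xu: "x u = x' u" using eq cone_ext_apply by metis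
    have R: "x \<in> realization B" "x' \<in> realization B" using x x' by (auto simp: S_def)
    show "x = x'"
    proof (cases "x u = 1")
      case True
      then show ?thesis using apex[OF R(1), of x'] apex[OF R(2), of x'] xu by metis
    next
      case False
      then have F: "x' u \<noteq> 1" using xu by simp
      have "c (max s (x u)) (base u x) = c (max s (x u)) (base u x')"
        using cone_ext_base[OF R(1) False s] cone_ext_base[OF R(2) F s] eq xu by simp
      moreover have "inj_on (c (max s (x u))) (realization (deletion B u))"
        using pseudo_isotopy_bij[OF c, of "max s (x u)"] ran[OF R(1)] x
        by (auto simp: bij_betw_def S_def)
      ultimately have "base u x = base u x'"
        using base_in[OF R(1) False] base_in[OF R(2) F] by (auto dest: inj_onD)
      then show ?thesis using join_base[of x u, OF False] join_base[of x' u, OF F] xu by metis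
    qed
  qed
  moreover have "cone_ext u c s ` S \<subseteq> S"
    using cone_ext_in[OF s] by (auto simp: S_def)
  moreover have "S \<subseteq> cone_ext u c s ` S"
  proof
    fix z assume z: "z \<in> S"
    then have R: "z \<in> realization B" by (simp add: S_def)
    show "z \<in> cone_ext u c s ` S"
    proof (cases "z u = 1")
      case True
      then have "cone_ext u c s z = z" using apex[OF R] unfolding cone_ext_def by metis
      then show ?thesis using z by force
    next
      case False
      let ?T = "max s (z u)"
      have T: "0 < ?T" "?T \<in> {0..1}" using z ran by (auto simp: S_def)
      \<comment> \<open>A preimage of \<open>z\<close> has the same height, hence the same time:
        pull the base of \<open>z\<close> back at that time and rejoin it.\<close>
      obtain y where y: "y \<in> realization (deletion B u)" "c ?T y = base u z"
        using pseudo_isotopy_bij[OF c, of ?T] T base_in[OF R False] unfolding bij_betw_def by force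
      define x where "x = join u (z u) y"
      have yu: "y u = 0" using y(1) by (simp add: realization_deletion_iff)
      have xu: "x u = z u" by (simp add: x_def)
      have "supp y = supp z - {u}"
        using pseudo_isotopyD(3)[OF c T(2) y(1) T(1)] y(2) supp_base[of z u, OF False] by simp
      then have "supp x = supp z"
        unfolding x_def supp_join[of "z u" y u, OF False yu] by (auto simp: supp_def)
      then have "x \<in> realization B"
        unfolding x_def using y(1) R realization_le_1[OF V R, of u] realization_iff[OF V, of z]
        by (intro join_in) auto
      then have "x \<in> S" using z by (simp add: S_def xu)
      moreover have "cone_ext u c s x = z"
      proof -
        have "base u x = y" unfolding x_def using False yu by (rule base_join)
        then show ?thesis unfolding cone_ext_def xu using y(2) join_base[of z u, OF False] by metis
      qed
      ultimately show ?thesis by force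
    qed
  qed
  ultimately show ?thesis by (auto simp: bij_betw_def)
qed

lemma cone_ext_deletion:
  assumes "0 \<le> s" "s \<le> 1" "x \<in> realization (deletion B u)"
  shows "cone_ext u c s x = c s x"
proof -
  have xu: "x u = 0" using assms by (simp add: realization_deletion_iff)
  then have "base u x = x" by (auto simp: base_def fun_eq_iff)
  moreover have "c s x u = 0"
    using pseudo_isotopyD(1)[OF c _ assms(3)] assms by (auto simp: realization_deletion_iff)
  ultimately show ?thesis using assms xu by (simp add: cone_ext_def join_0)
qed

text \<open>Only the apex is critical, where \<open>base\<close> is undefined in effect; there the
  factor \<open>1 - x u\<close> tends to 0 and multiplies a bounded coordinate.\<close>

lemma cone_ext_continuous:
  "continuous_on ({0..1} \<times> realization B) (\<lambda>p. cone_ext u c (fst p) (snd p))"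
proof (rule continuous_on_coordinatewise_then_product)
  fix w
  let ?S = "{0..1} \<times> realization B"
  show "continuous_on ?S (\<lambda>p. cone_ext u c (fst p) (snd p) w)"
  proof (cases "w = u")
    case True
    then show ?thesis by (simp add: continuous_on_snd_coord)
  next
    case False
    let ?m = "\<lambda>p::real \<times> ('v \<Rightarrow> real). 1 - snd p u"
    let ?y = "\<lambda>p. c (max (fst p) (snd p u)) (base u (snd p))"
    let ?D = "{p \<in> ?S. ?m p \<noteq> 0}"
    have R: "max (fst p) (snd p u) \<in> {0..1} \<and> base u (snd p) \<in> realization (deletion B u)" if "p \<in> ?D" for p
      using that realization_le_1[OF V, of "snd p" u] base_in[of "snd p"] by auto
    have "continuous_on ?D (\<lambda>p. base u (snd p))"
    proof (rule continuous_on_coordinatewise_then_product)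
      fix i show "continuous_on ?D (\<lambda>p. base u (snd p) i)"
      proof (cases "i = u")
        case True
        then show ?thesis by (simp add: base_def)
      next
        case False
        have "continuous_on ?D (\<lambda>p. snd p i / (1 - snd p u))"
          by (intro continuous_on_divide continuous_on_diff continuous_on_const continuous_on_snd_coord) auto
        then show ?thesis using False by (simp add: base_def)
      qed
    qed
    then have "continuous_on ?D ?y"
      by (intro pseudo_isotopy_compose[OF c] R continuous_on_max continuous_on_fst continuous_on_id
          continuous_on_snd_coord)
    then have "continuous_on ?D (\<lambda>p. ?y p w)" by (rule continuous_on_product_then_coordinatewise)
    moreover have "\<bar>?y p w\<bar> \<le> 1" if "p \<in> ?S" "?m p \<noteq> 0" for p
    proof -
      have "?y p \<in> realization B"
        using R[of p] that pseudo_isotopyD(1)[OF c] by (auto simp: realization_deletion_iff)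
      then show ?thesis
        using realization_le_1[OF V, of "?y p" w] realization_iff[OF V, of "?y p"] by auto
    qed
    ultimately have "continuous_on ?S (\<lambda>p. ?m p * ?y p w)"
      by (intro continuous_on_mult_bounded continuous_on_diff continuous_on_const continuous_on_snd_coord)
    then show ?thesis using False by (simp add: cone_ext_def join_def)
  qed
qed

lemma cone_ext_pseudo_isotopy: "pseudo_isotopy B (cone_ext u c)"
proof -
  have "bij_betw (cone_ext u c t) (realization B) (realization B)" if "0 < t" "t \<le> 1" for t
  proof -
    have "{x \<in> realization B. 0 < max t (x u)} = realization B" using that by auto
    then show ?thesis using cone_ext_bij[of t] that by simp
  qed
  moreover have "supp (cone_ext u c t x) = supp x" if "0 < t" "t \<le> 1" "x \<in> realization B" for t x
  proof -
    have "0 < max t (x u)" using that by simp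
    then show ?thesis using cone_ext_in[of t x] that by simp
  qed
  ultimately show ?thesis
    unfolding pseudo_isotopy_def using cone_ext_continuous cone_ext_in by auto
qed

text \<open>This is the bijectivity on new points that \<open>pushout_homeomorphic_map\<close> asks
  for, available although \<open>c 0\<close> itself need not be injective.\<close>

lemma cone_ext_0_bij:
  "bij_betw (cone_ext u c 0) (realization B - realization (deletion B u))
    (realization B - realization (deletion B u))"
proof -
  have "{x \<in> realization B. 0 < max 0 (x u)} = realization B - realization (deletion B u)"
    using realization_iff[OF V] by (auto simp: realization_deletion_iff less_le)
  then show ?thesis using cone_ext_bij[of 0] by simp
qed

end
end

section \<open>Extension over a dominated star\<close>

text \<open>At \<open>t = 0\<close> this is the composite of the retractions \<open>push\<close> of all elementary collapses of the
  star of \<open>v\<close>: every one of them lowers the coordinate at \<open>v\<close> and all other positive coordinates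
  except that at \<open>a\<close> by the same amount, hence \<open>x\<^sub>u\<close> ends up as the positive part of \<open>x\<^sub>u - x\<^sub>v\<close>. The
  coordinate at \<open>a\<close> is written as the complement to total mass \<open>1\<close>.\<close>

definition drain :: "'v set \<Rightarrow> 'v \<Rightarrow> 'v \<Rightarrow> real \<Rightarrow> ('v \<Rightarrow> real) \<Rightarrow> ('v \<Rightarrow> real)" where
  "drain V v a t x = (\<lambda>w. if w = v then 0
     else if w = a then 1 - (\<Sum>u\<in>V - {v, a}. max (t * x u) (x u - x v))
     else max (t * x w) (x w - x v))"

text \<open>If \<open>x a + x v = 0\<close>, division by zero puts no mass on \<open>v\<close> and \<open>a\<close>; this is harmless since
  \<open>y a = 0\<close> in all uses (\<open>split_mass_pos\<close>).\<close>

definition split_mass :: "'v \<Rightarrow> 'v \<Rightarrow> ('v \<Rightarrow> real) \<Rightarrow> ('v \<Rightarrow> real) \<Rightarrow> ('v \<Rightarrow> real)" where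
  "split_mass v a x y = (\<lambda>w. if w = v then y a * (x v / (x a + x v))
     else if w = a then y a * (x a / (x a + x v)) else y w)"

text \<open>A lift of \<open>c t\<close> after \<open>drain\<close> through the retraction onto
  \<open>a\<close>. Its value at \<open>t = 0\<close> carries the comparison of stages across a
  dominated vertex.\<close>

definition dominated_ext ::
    "'v set \<Rightarrow> 'v \<Rightarrow> 'v \<Rightarrow> (real \<Rightarrow> ('v \<Rightarrow> real) \<Rightarrow> ('v \<Rightarrow> real)) \<Rightarrow> real \<Rightarrow> ('v \<Rightarrow> real) \<Rightarrow> ('v \<Rightarrow> real)" where
  "dominated_ext V v a c t x = split_mass v a x (c t (drain V v a t x))"

lemma ratio_bounds:
  assumes "0 \<le> (p::real)" "0 \<le> q"
  shows "0 \<le> p / (q + p)" "p / (q + p) \<le> 1" "0 \<le> q / (q + p)" "q / (q + p) \<le> 1"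
  using assms by (auto simp: divide_le_eq_1)

text \<open>Domination enters only as closure under adding \<open>a\<close> to simplices that
  contain \<open>v\<close>.\<close>

locale dominated_vertex =
  fixes B :: "'v set set" and v a :: 'v and V
  assumes V: "finite V" "\<Union>B \<subseteq> V" and vV: "v \<in> V" "a \<in> V" "v \<noteq> a" and B: "abs_complex B"
    and dom: "\<And>\<sigma>. \<sigma> \<in> B \<Longrightarrow> v \<in> \<sigma> \<Longrightarrow> insert a \<sigma> \<in> B"
begin

abbreviation "W \<equiv> V - {v, a}"

lemma sum_V: "sum x V = x v + x a + sum x W"
proof -
  have "V = insert v (insert a W)" using vV by auto
  moreover have "finite W" using V by simp
  ultimately show ?thesis using vV(3)
    by (metis (no_types, lifting) Diff_iff add.assoc insertI1 insertI2 insert_iff sum.insert finite_insert)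
qed

lemma pointD:
  assumes "x \<in> realization B"
  shows "supp x \<in> B" "0 \<le> x w" "x w \<le> 1" "x v + x a + sum x W = 1" "w \<notin> V \<Longrightarrow> x w = 0"
  using assms realization_iff[OF V, of x] realization_le_1[OF V, of x] V(2) sum_V[of x]
  by (auto simp: supp_def)

lemma in_realization_iff:
  "x \<in> realization B \<longleftrightarrow> supp x \<in> B \<and> (\<forall>w. 0 \<le> x w) \<and> x v + x a + sum x W = 1"
  using realization_iff[OF V, of x] sum_V[of x] by auto

lemma in_deletion_iff:
  "x \<in> realization (deletion B v) \<longleftrightarrow> x \<in> realization B \<and> x v = 0"
  by (auto simp: realization_def deletion_def supp_def)

lemma retraction_eq:
  assumes "x \<in> realization B"
  shows "domination_retraction v a x = (\<lambda>w. if w = v then 0 else if w = a then x a + x v else x w)"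
proof
  fix u
  note x = pointD[OF assms]
  have fin: "finite (supp x)" using abs_complexD(1)[OF B x(1)] .
  have "domination_retraction v a x u = (\<Sum>w\<in>{w \<in> supp x. (id(v := a)) w = u}. x w)"
    by (simp add: domination_retraction_def realization_map_def)
  also have "\<dots> = (\<Sum>w\<in>{w \<in> insert u {v}. (id(v := a)) w = u}. x w)"
  proof (cases "u = v")
    case True
    then show ?thesis using vV by (auto intro: sum.cong)
  next
    case False
    show ?thesis
      by (rule sum.mono_neutral_cong) (use fin in \<open>auto simp: supp_def split: if_splits\<close>)
  qed
  also have "\<dots> = (if u = v then 0 else if u = a then x a + x v else x u)"
  proof -
    have "{w \<in> insert u {v}. (id(v := a)) w = u} = (if u = v then {} else if u = a then {a, v} else {u})"
      using vV by auto
    then show ?thesis using vV(3) by auto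
  qed
  finally show "domination_retraction v a x u = (if u = v then 0 else if u = a then x a + x v else x u)" .
qed

lemma supp_nonempty: "x v + x a + sum x W = 1 \<Longrightarrow> supp x \<noteq> {}"
proof
  assume "x v + x a + sum x W = 1" "supp x = {}"
  moreover from this have "x = (\<lambda>_. 0)" by (auto simp: supp_def)
  ultimately show False by simp
qed

lemma supp_ins_in: "x \<in> realization B \<Longrightarrow> x v \<noteq> 0 \<Longrightarrow> insert a (supp x) \<in> B"
  using dom[OF pointD(1)] by (auto simp: supp_def)

lemma drain_deletion:
  assumes "x \<in> realization (deletion B v)" "0 \<le> t" "t \<le> 1"
  shows "drain V v a t x = x"
proof -
  have x: "x \<in> realization B" "x v = 0" using assms by (auto simp: in_deletion_iff)
  have "max (t * x w) (x w) = x w" for w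
    using mult_right_mono[OF assms(3) pointD(2)[OF x(1)], of w] by simp
  then show ?thesis using pointD(4)[OF x(1)] x(2) by (auto simp: drain_def fun_eq_iff)
qed

text \<open>For \<open>t\<close> at most 1 no other coordinate grows, so \<open>a\<close> receives
  the mass of \<open>v\<close> and whatever the others lose.\<close>

lemma drain_a_ge:
  assumes x: "x \<in> realization B" and t: "0 \<le> t" "t \<le> 1"
  shows "x a + x v \<le> drain V v a t x a"
proof -
  have "max (t * x w) (x w - x v) \<le> x w" for w
    using mult_right_mono[OF t(2) pointD(2)[OF x], of w] pointD(2)[OF x, of v] by simp
  then have "(\<Sum>u\<in>W. max (t * x u) (x u - x v)) \<le> sum x W" by (intro sum_mono)
  then show ?thesis using pointD(4)[OF x] vV by (simp add: drain_def)
qed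

text \<open>When \<open>v\<close> carries mass, the new support lies in
  \<open>insert a (supp x)\<close>, a simplex by \<open>dom\<close>. For \<open>t > 0\<close> the
  term \<open>t * x w\<close> keeps every other positive coordinate positive.\<close>

lemma drain_in:
  assumes x: "x \<in> realization B" and t: "0 \<le> t" "t \<le> 1"
  shows "drain V v a t x \<in> realization (deletion B v)"
    and "supp (drain V v a t x) \<subseteq> (supp x - {v}) \<union> (if x v = 0 then {} else {a})"
    and "0 < t \<Longrightarrow> supp (drain V v a t x) = (supp x - {v}) \<union> (if x v = 0 then {} else {a})"
proof -
  note p = pointD[OF x]
  let ?d = "drain V v a t x"
  have nn: "0 \<le> ?d w" for w
  proof -
    have "0 \<le> ?d a" using drain_a_ge[OF x t] p(2)[of a] p(2)[of v] by linarith
    moreover have "0 \<le> ?d w" if "w \<noteq> a"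
      using p(2)[of w] t that by (auto simp: drain_def max.coboundedI1)
    ultimately show ?thesis by blast
  qed
  have sub: "supp ?d \<subseteq> (supp x - {v}) \<union> (if x v = 0 then {} else {a})"
  proof (cases "x v = 0")
    case True
    then have "?d = x" using drain_deletion[of x t] x t by (simp add: in_deletion_iff)
    then show ?thesis using True by (auto simp: supp_def)
  next
    case False
    then show ?thesis using p(2)[of v] by (auto simp: supp_def drain_def max_def split: if_splits)
  qed
  then show "supp ?d \<subseteq> (supp x - {v}) \<union> (if x v = 0 then {} else {a})" .
  have s: "?d v + ?d a + sum ?d W = 1"
    using vV by (auto simp: drain_def)
  then have "supp ?d \<noteq> {}" by (rule supp_nonempty)
  moreover have "\<exists>\<tau>\<in>B. supp ?d \<subseteq> \<tau>"
  proof (cases "x v = 0")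
    case True
    then show ?thesis using sub p(1) by auto
  next
    case False
    then show ?thesis using sub supp_ins_in[OF x False]
      by (intro bexI[of _ "insert a (supp x)"]) auto
  qed
  ultimately have "supp ?d \<in> B" using abs_complexD(3)[OF B] by blast
  then show "?d \<in> realization (deletion B v)"
    using nn s by (auto simp: in_deletion_iff in_realization_iff drain_def)
  show "supp ?d = (supp x - {v}) \<union> (if x v = 0 then {} else {a})" if "0 < t"
  proof (intro equalityI sub subsetI)
    fix w assume w: "w \<in> (supp x - {v}) \<union> (if x v = 0 then {} else {a})"
    show "w \<in> supp ?d"
    proof (cases "w = a")
      case True
      then have "0 < x a + x v" using w p(2)[of a] p(2)[of v] by (auto simp: supp_def less_le split: if_splits)
      then show ?thesis using drain_a_ge[OF x t] True by (auto simp: supp_def)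
    next
      case False
      then have "w \<noteq> v" "0 < x w" using w p(2)[of w] by (auto simp: supp_def less_le split: if_splits)
      moreover from this have "0 < t * x w" using that by simp
      ultimately show ?thesis using False by (auto simp: supp_def drain_def)
    qed
  qed
qed

lemma split_mass_pos:
  assumes x: "x \<in> realization B" and y: "y \<in> realization (deletion B v)"
    and sub: "supp y \<subseteq> (supp x - {v}) \<union> (if x v = 0 then {} else {a})"
  shows "y a = 0 \<or> 0 < x a + x v"
  using sub pointD(2)[OF x, of a] pointD(2)[OF x, of v]
  by (cases "x a = 0"; cases "x v = 0") (auto simp: supp_def less_le)

text \<open>The two shares add up to \<open>y a\<close>, so the retraction merges them back to
  \<open>y\<close>. A share can be nonzero only where \<open>x\<close> is, which keeps the support
  inside \<open>supp x\<close>.\<close>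

lemma split_mass_in:
  assumes x: "x \<in> realization B" and y: "y \<in> realization (deletion B v)"
    and sub: "supp y \<subseteq> (supp x - {v}) \<union> (if x v = 0 then {} else {a})"
  shows "split_mass v a x y \<in> realization B"
    and "supp (split_mass v a x y) \<subseteq> supp x"
    and "domination_retraction v a (split_mass v a x y) = y"
    and "supp y = (supp x - {v}) \<union> (if x v = 0 then {} else {a}) \<Longrightarrow> supp (split_mass v a x y) = supp x"
proof -
  note p = pointD[OF x]
  have yB: "y \<in> realization B" and yv: "y v = 0" using y by (auto simp: in_deletion_iff)
  note py = pointD[OF yB]
  let ?s = "split_mass v a x y"
  note pos = split_mass_pos[OF assms]
  have e: "?s v + ?s a = y a"
  proof -
    have "?s v + ?s a = y a * ((x a + x v) / (x a + x v))"
      using vV by (simp add: split_mass_def distrib_left[symmetric] add_divide_distrib[symmetric] add.commute)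
    then show ?thesis using pos by auto
  qed
  have nn: "0 \<le> ?s w" for w
    using py(2) ratio_bounds[OF p(2)[of v] p(2)[of a]]
    by (simp add: split_mass_def del: times_divide_eq_right)
  have sW: "sum ?s W = sum y W" by (rule sum.cong) (auto simp: split_mass_def)
  have s: "?s v + ?s a + sum ?s W = 1" using py(4) yv e sW by simp
  show sub2: "supp ?s \<subseteq> supp x"
    using sub by (auto simp: supp_def split_mass_def split: if_splits)
  have "supp ?s \<noteq> {}" using s by (rule supp_nonempty)
  then have "supp ?s \<in> B" using abs_complexD(3)[OF B p(1) sub2] by blast
  then show sB: "?s \<in> realization B" using nn s by (simp add: in_realization_iff)
  show "domination_retraction v a ?s = y"
    unfolding retraction_eq[OF sB] using e yv by (auto simp: split_mass_def fun_eq_iff)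
  assume eq: "supp y = (supp x - {v}) \<union> (if x v = 0 then {} else {a})"
  show "supp ?s = supp x"
  proof (intro equalityI sub2 subsetI)
    fix w assume w: "w \<in> supp x"
    then have xw: "0 < x w" using p(2)[of w] by (auto simp: supp_def less_le)
    show "w \<in> supp ?s"
    proof (cases "w = v \<or> w = a")
      case True
      then have "a \<in> supp y" using eq w vV by (auto simp: supp_def)
      then have "y a \<noteq> 0" by (simp add: supp_def)
      moreover have "x a + x v > 0" using True xw p(2)[of a] p(2)[of v] by auto
      ultimately show ?thesis using True xw by (auto simp: supp_def split_mass_def)
    next
      case False
      then have "w \<in> supp y" using eq w by auto
      then show ?thesis using False by (auto simp: supp_def split_mass_def)
    qed
  qed
qed

context
  fixes c
  assumes c: "pseudo_isotopy (deletion B v) c"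
begin

lemma c_drain:
  assumes x: "x \<in> realization B" and t: "0 \<le> t" "t \<le> 1"
  shows "c t (drain V v a t x) \<in> realization (deletion B v)"
    and "supp (c t (drain V v a t x)) \<subseteq> (supp x - {v}) \<union> (if x v = 0 then {} else {a})"
    and "0 < t \<Longrightarrow> supp (c t (drain V v a t x)) = (supp x - {v}) \<union> (if x v = 0 then {} else {a})"
proof -
  have t': "t \<in> {0..1}" using t by simp
  note d = drain_in[OF x t] and cd = pseudo_isotopyD[OF c t' drain_in(1)[OF x t]]
  show "c t (drain V v a t x) \<in> realization (deletion B v)" by (rule cd)
  show "supp (c t (drain V v a t x)) \<subseteq> (supp x - {v}) \<union> (if x v = 0 then {} else {a})"
    using cd(2) d(2) by (rule subset_trans)
  show "0 < t \<Longrightarrow> supp (c t (drain V v a t x)) = (supp x - {v}) \<union> (if x v = 0 then {} else {a})"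
    using cd(3) d(3) by simp
qed

lemma dominated_ext_in:
  assumes x: "x \<in> realization B" and t: "0 \<le> t" "t \<le> 1"
  shows "dominated_ext V v a c t x \<in> realization B"
    and "supp (dominated_ext V v a c t x) \<subseteq> supp x"
    and "domination_retraction v a (dominated_ext V v a c t x) = c t (drain V v a t x)"
    and "0 < t \<Longrightarrow> supp (dominated_ext V v a c t x) = supp x"
  unfolding dominated_ext_def using split_mass_in[OF x c_drain(1,2)[OF x t]] c_drain(3)[OF x t] by auto

text \<open>Of two points with the same image, let \<open>x\<close> have the smaller total mass on
  \<open>a\<close> and \<open>v\<close>. Then \<open>x\<close> is coordinatewise at most
  \<open>x'\<close>, and since both have mass 1 they agree.\<close>

lemma dominated_ext_inj:
  assumes t: "0 < t" "t \<le> 1"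
  shows "inj_on (dominated_ext V v a c t) (realization B)"
proof
  have t0: "0 \<le> t" using t by simp
  have main: "x = x'" if x: "x \<in> realization B" and x': "x' \<in> realization B"
    and eq: "dominated_ext V v a c t x = dominated_ext V v a c t x'"
    and le: "x a + x v \<le> x' a + x' v" for x x'
  proof -
    note p = pointD[OF x] and p' = pointD[OF x']
    have ceq: "c t (drain V v a t x) = c t (drain V v a t x')"
      using dominated_ext_in(3)[OF x t0 t(2)] dominated_ext_in(3)[OF x' t0 t(2)] eq by metis
    then have deq: "drain V v a t x = drain V v a t x'"
      using pseudo_isotopy_bij[OF c t] drain_in(1)[OF x t0 t(2)] drain_in(1)[OF x' t0 t(2)]
      by (auto simp: bij_betw_def dest: inj_onD)
    have seq: "supp x = supp x'"
      using dominated_ext_in(4)[OF x t0 t(2) t(1)] dominated_ext_in(4)[OF x' t0 t(2) t(1)] eq by metis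
    \<comment> \<open>If \<open>v\<close> carries mass, then \<open>y a\<close> is nonzero and
      cancels, so the shares of \<open>v\<close> and \<open>a\<close> agree for both points and the
      larger total gives larger coordinates. Otherwise equal supports give
      \<open>x' v = 0\<close>.\<close>
    have av: "x v \<le> x' v \<and> x a \<le> x' a"
    proof (cases "x v = 0")
      case True
      then have "x' v = 0" using seq by (auto simp: supp_def)
      then show ?thesis using True le by simp
    next
      case False
      define y where "y = c t (drain V v a t x)"
      have "a \<in> supp y" using c_drain(3)[OF x t0 t(2) t(1)] False by (auto simp: y_def)
      then have "y a \<noteq> 0" by (simp add: supp_def)
      moreover have "y a * (x v / (x a + x v)) = y a * (x' v / (x' a + x' v))"
        "y a * (x a / (x a + x v)) = y a * (x' a / (x' a + x' v))"
        using fun_cong[OF eq, of v] fun_cong[OF eq, of a] ceq vV(3)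
        by (auto simp: dominated_ext_def split_mass_def y_def)
      ultimately have r: "x v / (x a + x v) = x' v / (x' a + x' v)"
        "x a / (x a + x v) = x' a / (x' a + x' v)" by (metis mult_left_cancel)+
      have S: "0 < x a + x v" using False p(2)[of v] p(2)[of a] by (simp add: less_le)
      have "x v = x v / (x a + x v) * (x a + x v)" using S by simp
      also have "\<dots> \<le> x v / (x a + x v) * (x' a + x' v)"
        using le by (rule mult_left_mono) (rule ratio_bounds(1)[OF p(2) p(2)])
      also have "\<dots> = x' v" using r(1) S le by simp
      finally have 1: "x v \<le> x' v" .
      have "x a = x a / (x a + x v) * (x a + x v)" using S by simp
      also have "\<dots> \<le> x a / (x a + x v) * (x' a + x' v)"
        using le by (rule mult_left_mono) (rule ratio_bounds(3)[OF p(2) p(2)])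
      also have "\<dots> = x' a" using r(2) S le by simp
      finally show ?thesis using 1 by simp
    qed
    \<comment> \<open>The drained coordinate is strictly increasing in \<open>x w\<close> and weakly
      decreasing in \<open>x v\<close>.\<close>
    have W: "x w \<le> x' w" if "w \<in> W" for w
    proof (rule ccontr)
      assume "\<not> x w \<le> x' w"
      then have lt: "x' w < x w" by simp
      moreover have "t * x' w < t * x w" using lt t(1) by simp
      ultimately have "max (t * x' w) (x' w - x' v) < max (t * x w) (x w - x v)"
        using av by (auto simp: max_def)
      moreover have "max (t * x w) (x w - x v) = max (t * x' w) (x' w - x' v)"
        using fun_cong[OF deq, of w] that by (simp add: drain_def)
      ultimately show False by simp
    qed
    have sW: "sum x W \<le> sum x' W" using W by (rule sum_mono)
    then have "x v = x' v" "x a = x' a" and s: "sum x W = sum x' W" using p(4) p'(4) av by linarith+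
    moreover have "x w = x' w" if "w \<in> W" for w
      using s by (rule sum_mono_inv) (use W that V in auto)
    ultimately have "x w = x' w" for w using p(5) p'(5) by (cases "w \<in> V") auto
    then show ?thesis by blast
  qed
  show "x = x'" if "x \<in> realization B" "x' \<in> realization B"
    "dominated_ext V v a c t x = dominated_ext V v a c t x'" for x x'
    using main[of x x'] main[of x' x] that by (cases "x a + x v \<le> x' a + x' v") auto
qed

text \<open>The retraction of \<open>z\<close>, pulled back by \<open>c t\<close>, prescribes the
  drained point \<open>b\<close>, and \<open>z\<close> prescribes the ratio of \<open>v\<close> to
  \<open>a\<close>. Only their total mass remains free, and the intermediate value theorem finds
  it.\<close>

lemma dominated_ext_surj:
  assumes t: "0 < t" "t \<le> 1" and z: "z \<in> realization B"
  shows "\<exists>x\<in>realization B. dominated_ext V v a c t x = z"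
proof -
  have t0: "0 \<le> t" using t by simp
  note pz = pointD[OF z]
  define y where "y = domination_retraction v a z"
  have y_eq: "y = (\<lambda>w. if w = v then 0 else if w = a then z a + z v else z w)"
    unfolding y_def by (rule retraction_eq[OF z])
  \<comment> \<open>At time 1 \<open>drain\<close> moves only the mass of \<open>v\<close>, so it is
    the domination retraction; thus \<open>drain_in\<close> applies to \<open>y\<close>.\<close>
  have yd: "y = drain V v a 1 z"
  proof -
    have "max (z w) (z w - z v) = z w" for w using pz(2)[of v] by simp
    then show ?thesis using pz(4) by (auto simp: y_eq drain_def fun_eq_iff)
  qed
  have y: "y \<in> realization (deletion B v)"
    unfolding yd by (rule drain_in(1)[OF z]) auto
  obtain b where b: "b \<in> realization (deletion B v)" "c t b = y"
    using pseudo_isotopy_bij[OF c t] y unfolding bij_betw_def by force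
  have bB: "b \<in> realization B" "b v = 0" using b(1) by (auto simp: in_deletion_iff)
  note pb = pointD[OF bB(1)]
  have sb: "supp b = supp y" using pseudo_isotopyD(3)[OF c _ b(1) t(1)] t b(2) by auto
  define \<kappa> where "\<kappa> = z v / (z a + z v)"
  have \<kappa>: "0 \<le> \<kappa>" "\<kappa> \<le> 1" unfolding \<kappa>_def by (rule ratio_bounds[OF pz(2) pz(2)])+
  \<comment> \<open>\<open>s\<close> stands for the total mass \<open>x a + x v\<close> of the preimage; given \<open>s\<close>, the ratio \<open>\<kappa>\<close> and the image \<open>b\<close>
    determine all coordinates of \<open>x\<close>, and \<open>F s = 1\<close> says that they sum to \<open>1\<close>.\<close>
  define F where "F s = s + (\<Sum>w\<in>W. min (b w / t) (b w + \<kappa> * s))" for s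
  \<comment> \<open>Since \<open>t\<close> is at most 1; hence at \<open>s = 0\<close> every minimum
    equals \<open>b w\<close>, and \<open>F 0 = 1 - b a\<close>.\<close>
  have bt: "b w \<le> b w / t" for w
    using pb(2)[of w] t mult_left_le[of t "b w"] by (simp add: le_divide_eq)
  have F0: "F 0 = 1 - b a" using pb(4) bB(2) bt by (simp add: F_def min_absorb2)
  have "F 0 \<le> 1" using F0 pb(2)[of a] by simp
  moreover have "1 \<le> F 1"
  proof -
    have "0 \<le> (\<Sum>w\<in>W. min (b w / t) (b w + \<kappa> * 1))"
      using pb(2) \<kappa> t0 by (intro sum_nonneg) simp
    then show ?thesis by (simp add: F_def)
  qed
  moreover have "continuous_on {0..1} F" unfolding F_def by (intro continuous_intros)
  ultimately obtain s where s: "0 \<le> s" "s \<le> 1" "F s = 1" using IVT'[of F 0 1 1] by auto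
  \<comment> \<open>The minimum inverts the drained coordinate: that one is the maximum of two
    increasing functions of \<open>x w\<close>, whose inverses are \<open>b w / t\<close> and
    \<open>b w + \<kappa> * s\<close>.\<close>
  define x where "x = (\<lambda>w. if w = v then \<kappa> * s else if w = a then (1 - \<kappa>) * s
    else min (b w / t) (b w + \<kappa> * s))"
  have xv: "x v = \<kappa> * s" and xa: "x a = (1 - \<kappa>) * s" and xw: "\<And>w. w \<noteq> v \<Longrightarrow> w \<noteq> a \<Longrightarrow> x w = min (b w / t) (b w + \<kappa> * s)"
    using vV(3) by (auto simp: x_def)
  have xs: "x a + x v = s" unfolding xv xa by (simp add: algebra_simps)
  have nn: "0 \<le> x w" for w
    using \<kappa> s pb(2) t0 by (auto simp: x_def)
  have "sum x W = (\<Sum>w\<in>W. min (b w / t) (b w + \<kappa> * s))" by (rule sum.cong) (auto simp: xw)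
  then have sum1: "x v + x a + sum x W = 1" using xs s(3) by (simp add: F_def)
  \<comment> \<open>The ratio formula divides by \<open>s\<close>, so \<open>s\<close> must vanish
    exactly when \<open>z\<close> has no mass on \<open>v\<close> and \<open>a\<close>.\<close>
  have s0: "s = 0 \<longleftrightarrow> z a + z v = 0"
  proof
    assume "s = 0"
    then have "b a = 0" using s(3) F0 by simp
    then have "a \<notin> supp y" using sb by (auto simp: supp_def)
    then show "z a + z v = 0" using vV by (auto simp: supp_def y_eq)
  next
    assume z0: "z a + z v = 0"
    then have "a \<notin> supp b" unfolding sb using vV by (auto simp: supp_def y_eq)
    then have "b a = 0" by (simp add: supp_def)
    moreover have "\<kappa> = 0" using z0 by (simp add: \<kappa>_def)
    ultimately have "F s = s + 1" using F0 by (simp add: F_def)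
    then show "s = 0" using s(3) by simp
  qed
  have x_zero: "x w = 0 \<longleftrightarrow> z w = 0" for w
  proof -
    consider "w = v" | "w = a" | "w \<noteq> v" "w \<noteq> a" by blast
    then show ?thesis
    proof cases
      case 1
      have "z v = 0" if "z a + z v = 0" using that pz(2)[of a] pz(2)[of v] by simp
      then show ?thesis using 1 s0 by (auto simp: xv \<kappa>_def)
    next
      case 2
      have "z a = 0" if "z a + z v = 0" using that pz(2)[of a] pz(2)[of v] by simp
      moreover have "1 - \<kappa> = z a / (z a + z v)" if "z a + z v \<noteq> 0"
        using that by (simp add: \<kappa>_def field_simps)
      ultimately show ?thesis using 2 s0 by (cases "z a + z v = 0") (auto simp: xa)
    next
      case 3
      have "b w = 0 \<longleftrightarrow> y w = 0" using sb by (auto simp: supp_def)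
      then have "b w = 0 \<longleftrightarrow> z w = 0" using 3 by (simp add: y_eq)
      moreover have "min (b w / t) (b w + \<kappa> * s) = 0 \<longleftrightarrow> b w = 0"
      proof (cases "b w = 0")
        case True
        then show ?thesis using \<kappa> s by simp
      next
        case False
        then have "0 < b w" using pb(2)[of w] by simp
        then have "0 < b w / t" "0 < b w + \<kappa> * s" using t \<kappa> s by (auto intro: add_pos_nonneg)
        then show ?thesis using False by (auto simp: min_def)
      qed
      ultimately show ?thesis using 3 by (simp add: xw)
    qed
  qed
  then have "supp x = supp z" by (simp add: supp_def)
  then have xB: "x \<in> realization B" using nn sum1 pz(1) by (simp add: in_realization_iff)
  have inv: "max (t * x w) (x w - x v) = b w" if w: "w \<noteq> v" "w \<noteq> a" for w
  proof (cases "b w / t \<le> b w + \<kappa> * s")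
    case True
    then have "x w = b w / t" using w by (simp add: xw)
    then show ?thesis using True t by (simp add: xv)
  next
    case False
    then have "x w = b w + \<kappa> * s" using w by (simp add: xw)
    moreover have "t * (b w + \<kappa> * s) \<le> b w"
      using False t by (simp add: not_le less_divide_eq mult.commute)
    ultimately show ?thesis by (simp add: xv)
  qed
  have "drain V v a t x = b"
  proof
    fix w
    have "(\<Sum>u\<in>W. max (t * x u) (x u - x v)) = sum b W" by (rule sum.cong) (auto simp: inv)
    then show "drain V v a t x w = b w"
      using pb(4) bB(2) inv[of w] by (auto simp: drain_def)
  qed
  then have "dominated_ext V v a c t x = split_mass v a x y" using b(2) by (simp add: dominated_ext_def)
  also have "\<dots> = z"
  proof
    fix w
    show "split_mass v a x y w = z w"
    proof (cases "z a + z v = 0")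
      case True
      then have "z a = 0" "z v = 0" using pz(2)[of a] pz(2)[of v] by auto
      then show ?thesis by (auto simp: split_mass_def y_eq)
    next
      case False
      then have "s \<noteq> 0" using s0 by simp
      have "split_mass v a x y v = (z a + z v) * \<kappa>" "split_mass v a x y a = (z a + z v) * (1 - \<kappa>)"
        using vV(3) \<open>s \<noteq> 0\<close> by (auto simp: split_mass_def y_eq xs) (simp_all add: xv xa)
      moreover have "(z a + z v) * \<kappa> = z v" "(z a + z v) * (1 - \<kappa>) = z a"
        using False by (auto simp: \<kappa>_def field_simps)
      ultimately show ?thesis by (auto simp: split_mass_def y_eq)
    qed
  qed
  finally show ?thesis using xB by blast
qed

text \<open>The shares may jump where \<open>x a + x v = 0\<close>, but there
  \<open>y a = 0\<close>; being bounded, they have continuous products with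
  \<open>y a\<close>.\<close>

lemma dominated_ext_continuous:
  "continuous_on ({0..1} \<times> realization B) (\<lambda>p. dominated_ext V v a c (fst p) (snd p))"
proof -
  let ?S = "{0..1} \<times> realization B"
  let ?y = "\<lambda>p. c (fst p) (drain V v a (fst p) (snd p))"
  note coord = continuous_on_snd_coord
  have m: "continuous_on ?S (\<lambda>p. max (fst p * snd p w) (snd p w - snd p v))" for w
    by (intro continuous_on_max continuous_on_mult continuous_on_diff continuous_on_fst continuous_on_id coord)
  have "continuous_on ?S (\<lambda>p. drain V v a (fst p) (snd p))"
  proof (rule continuous_on_coordinatewise_then_product)
    fix i
    have "continuous_on ?S (\<lambda>p. 1 - (\<Sum>u\<in>W. max (fst p * snd p u) (snd p u - snd p v)))"
      by (intro continuous_on_diff continuous_on_sum continuous_on_const m)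
    then show "continuous_on ?S (\<lambda>p. drain V v a (fst p) (snd p) i)"
      unfolding drain_def using m[of i] by (cases "i = v"; cases "i = a") auto
  qed
  then have "continuous_on ?S ?y"
    by (intro pseudo_isotopy_compose[OF c] continuous_on_fst continuous_on_id) (auto intro: drain_in)
  then have y: "continuous_on ?S (\<lambda>p. ?y p w)" for w by (rule continuous_on_product_then_coordinatewise)
  have pos: "snd p a + snd p v \<noteq> 0" if "p \<in> ?S" "?y p a \<noteq> 0" for p
    using split_mass_pos[OF _ c_drain(1,2), of "snd p" "fst p"] that by auto
  let ?D = "{p \<in> ?S. ?y p a \<noteq> 0}"
  have r: "continuous_on ?D (\<lambda>p. snd p w / (snd p a + snd p v))" for w
    by (intro continuous_on_divide continuous_on_add coord) (use pos in auto)
  have nn: "0 \<le> snd p w" if "p \<in> ?S" for p w using that pointD(2) by auto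
  have r1: "\<bar>snd p v / (snd p a + snd p v)\<bar> \<le> 1 \<and> \<bar>snd p a / (snd p a + snd p v)\<bar> \<le> 1"
    if "p \<in> ?S" for p
    using ratio_bounds[OF nn[OF that, of v] nn[OF that, of a]] by (metis abs_of_nonneg)
  have "continuous_on ?S (\<lambda>p. ?y p a * (snd p v / (snd p a + snd p v)))"
    by (intro continuous_on_mult_bounded y r)
      (use r1 in blast)
  moreover have "continuous_on ?S (\<lambda>p. ?y p a * (snd p a / (snd p a + snd p v)))"
    by (intro continuous_on_mult_bounded y r)
      (use r1 in blast)
  ultimately have "continuous_on ?S (\<lambda>p. dominated_ext V v a c (fst p) (snd p) w)" for w
    unfolding dominated_ext_def split_mass_def using y[of w] by (cases "w = v"; cases "w = a") simp_all
  then show ?thesis by (rule continuous_on_coordinatewise_then_product)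
qed

lemma dominated_ext_pseudo_isotopy: "pseudo_isotopy B (dominated_ext V v a c)"
proof -
  have "bij_betw (dominated_ext V v a c t) (realization B) (realization B)" if "0 < t" "t \<le> 1" for t
    using dominated_ext_inj[OF that] dominated_ext_in(1)[of _ t] dominated_ext_surj[OF that] that
    by (force simp: bij_betw_def)
  then show ?thesis
    unfolding pseudo_isotopy_def using dominated_ext_continuous dominated_ext_in by auto
qed

end
end

section \<open>Elementary collapses\<close>

lemma continuous_on_Min:
  fixes f :: "'i \<Rightarrow> 'a::topological_space \<Rightarrow> real"
  assumes "finite I" "I \<noteq> {}" "\<And>i. i \<in> I \<Longrightarrow> continuous_on S (f i)"
  shows "continuous_on S (\<lambda>x. Min ((\<lambda>i. f i x) ` I))"
  using assms
proof (induction I rule: finite_ne_induct)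
  case (insert i I)
  then show ?case by (auto intro!: continuous_on_min)
qed auto

text \<open>All vertices of \<sigma> lose mass equally and \<open>a\<close> gains it, until at
  \<open>s = 1\<close> the smallest coordinate on \<sigma> is used up.\<close>

definition push :: "'v set \<Rightarrow> 'v \<Rightarrow> real \<Rightarrow> ('v \<Rightarrow> real) \<Rightarrow> ('v \<Rightarrow> real)" where
  "push \<sigma> a s x = (\<lambda>w. x w + s * Min (x ` \<sigma>) * (if w = a then real (card \<sigma>) else if w \<in> \<sigma> then -1 else 0))"

lemma push_id: "push \<sigma> a 0 x = x"
  by (simp add: push_def)

locale elementary_collapse =
  fixes L :: "'v set set" and \<sigma> :: "'v set" and a :: 'v
  assumes L: "finite L" "abs_complex L" and \<sigma>: "\<sigma> \<in> L" "a \<notin> \<sigma>" "insert a \<sigma> \<in> L"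
    and free: "{\<rho> \<in> L. \<sigma> \<subset> \<rho>} = {insert a \<sigma>}"
begin

abbreviation "\<tau> \<equiv> insert a \<sigma>"
abbreviation "L' \<equiv> L - {\<sigma>, \<tau>}"

lemma fin_\<sigma>: "finite \<sigma>" "\<sigma> \<noteq> {}"
  using abs_complexD[OF L(2) \<sigma>(1)] by auto

text \<open>A positive minimum forces \<sigma> into the support; freeness then leaves only \<sigma>
  and \<tau>. Hence \<open>push\<close> moves only points in these two open simplices.\<close>

lemma Min_pos:
  assumes x: "x \<in> realization L"
  shows "0 \<le> Min (x ` \<sigma>)" "w \<in> \<sigma> \<Longrightarrow> Min (x ` \<sigma>) \<le> x w" "\<exists>w\<in>\<sigma>. x w = Min (x ` \<sigma>)"
    "Min (x ` \<sigma>) \<noteq> 0 \<Longrightarrow> supp x \<in> {\<sigma>, \<tau>}"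
proof -
  have nn: "0 \<le> x w" for w using x by (auto simp: realization_def)
  have "Min (x ` \<sigma>) \<in> x ` \<sigma>" using fin_\<sigma> by (intro Min_in) auto
  then show "0 \<le> Min (x ` \<sigma>)" "\<exists>w\<in>\<sigma>. x w = Min (x ` \<sigma>)" using nn by auto
  have le: "Min (x ` \<sigma>) \<le> x w" if "w \<in> \<sigma>" for w using fin_\<sigma> that by auto
  then show "w \<in> \<sigma> \<Longrightarrow> Min (x ` \<sigma>) \<le> x w" by blast
  assume "Min (x ` \<sigma>) \<noteq> 0"
  then have "0 < Min (x ` \<sigma>)" using \<open>0 \<le> Min (x ` \<sigma>)\<close> by simp
  then have "\<sigma> \<subseteq> supp x" using le by (force simp: supp_def)
  moreover have "supp x \<in> L" using x by (simp add: realization_def)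
  ultimately show "supp x \<in> {\<sigma>, \<tau>}" using free by blast
qed

lemma Min_0:
  assumes "x \<in> realization L'"
  shows "Min (x ` \<sigma>) = 0"
  using Min_pos(4)[of x] assms realization_mono[of L' L] by (auto simp: realization_def)

lemma push_fix: "x \<in> realization L' \<Longrightarrow> push \<sigma> a s x = x"
  by (simp add: push_def Min_0)

lemma push_in:
  assumes x: "x \<in> realization L" and s: "0 \<le> s" "s \<le> 1"
  shows "push \<sigma> a s x \<in> realization L"
    and "supp x \<subseteq> \<tau> \<Longrightarrow> supp (push \<sigma> a s x) \<subseteq> \<tau>"
proof -
  define m where "m = Min (x ` \<sigma>)"
  define V where "V = \<Union>L"
  have V: "finite V" "\<Union>L \<subseteq> V" using finite_Union_complex[OF L] by (auto simp: V_def)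
  have xV: "supp x \<in> L" "\<And>w. 0 \<le> x w" "sum x V = 1" using x realization_iff[OF V] by auto
  show sub: "supp (push \<sigma> a s x) \<subseteq> \<tau>" if "supp x \<subseteq> \<tau>" for s
    using that by (auto simp: push_def supp_def)
  show "push \<sigma> a s x \<in> realization L"
  proof (cases "m = 0")
    case True
    then show ?thesis using x by (simp add: push_def m_def)
  next
    case False
    let ?e = "\<lambda>w. if w = a then real (card \<sigma>) else if w \<in> \<sigma> then -1 else 0"
    have "sum ?e V = sum ?e \<tau>"
      by (rule sum.mono_neutral_right) (use V \<sigma> in auto)
    also have "\<dots> = real (card \<sigma>) + (\<Sum>w\<in>\<sigma>. -1)"
    proof -
      have "sum ?e \<sigma> = (\<Sum>w\<in>\<sigma>. -1)" by (rule sum.cong) (use \<sigma> in auto)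
      then show ?thesis using fin_\<sigma> \<sigma> by simp
    qed
    finally have "sum ?e V = 0" by simp
    then have s1: "sum (push \<sigma> a s x) V = 1"
      using xV(3) by (simp only: push_def sum.distrib sum_distrib_left[symmetric])
    have "0 \<le> push \<sigma> a s x w" for w
    proof -
      have "s * m \<le> m" using s Min_pos(1)[OF x] by (simp add: m_def mult_left_le_one_le)
      then have "w \<in> \<sigma> \<Longrightarrow> s * m \<le> x w" using Min_pos(2)[OF x] by (force simp: m_def)
      then show ?thesis using xV(2)[of w] s Min_pos(1)[OF x] by (auto simp: push_def m_def)
    qed
    moreover have "supp (push \<sigma> a s x) \<noteq> {}"
    proof
      assume "supp (push \<sigma> a s x) = {}"
      then have "push \<sigma> a s x = (\<lambda>_. 0)" by (auto simp: supp_def)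
      then show False using s1 by simp
    qed
    then have "supp (push \<sigma> a s x) \<in> L"
      using abs_complexD(3)[OF L(2) \<sigma>(3) sub] Min_pos(4)[OF x] False by (auto simp: m_def)
    ultimately show ?thesis using s1 realization_iff[OF V] by blast
  qed
qed

text \<open>A vertex of \<sigma> with minimal coordinate is emptied, so the support is neither
  \<sigma> nor \<tau>.\<close>

lemma push_1_in:
  assumes x: "x \<in> realization L"
  shows "push \<sigma> a 1 x \<in> realization L'"
proof -
  obtain w where w: "w \<in> \<sigma>" "x w = Min (x ` \<sigma>)" using Min_pos(3)[OF x] by blast
  then have "push \<sigma> a 1 x w = 0" using \<sigma>(2) by (auto simp: push_def)
  then have "supp (push \<sigma> a 1 x) \<notin> {\<sigma>, \<tau>}" using w(1) by (auto simp: supp_def)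
  then show ?thesis using push_in(1)[OF x, of 1] by (simp add: realization_def)
qed

lemma push_continuous: "continuous_on (T \<times> S) (\<lambda>p. push \<sigma> a (fst p) (snd p))"
proof (rule continuous_on_coordinatewise_then_product)
  fix w
  show "continuous_on (T \<times> S) (\<lambda>p. push \<sigma> a (fst p) (snd p) w)"
    unfolding push_def
    by (intro continuous_on_add continuous_on_mult continuous_on_fst continuous_on_id continuous_on_const
        continuous_on_snd_coord continuous_on_Min fin_\<sigma>)
qed

lemma push_strong_deformation_retraction:
  "strong_deformation_retraction (realization L) (realization L') (push \<sigma> a 1)"
  unfolding strong_deformation_retraction_def retraction_def
proof (intro conjI)
  have "continuous_on (realization L) (\<lambda>x. (\<lambda>p. push \<sigma> a (fst p) (snd p)) (1, x))"
    by (rule continuous_on_compose2[OF push_continuous[of "{1}" "realization L"]])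
      (auto intro!: continuous_on_Pair continuous_on_id continuous_on_const)
  then show "continuous_on (realization L) (push \<sigma> a 1)" by simp
  show "homotopic_with_canon (\<lambda>h. \<forall>x\<in>realization L'. h x = x) (realization L) (realization L) id (push \<sigma> a 1)"
    unfolding homotopic_with_def
  proof (intro exI conjI allI ballI)
    let ?h = "\<lambda>p. push \<sigma> a (fst p) (snd p)"
    show "continuous_map (prod_topology (top_of_set {0..1}) (top_of_set (realization L)))
        (top_of_set (realization L)) ?h"
      using push_continuous[of "{0..1}" "realization L"] push_in(1)
      by (auto simp: prod_topology_subtopology_eu continuous_map_in_subtopology)
  qed (auto simp: push_id push_fix)
qed (use push_1_in push_fix realization_mono[of L' L] in auto)

lemma push_image:
  "push \<sigma> a 1 ` realization {\<mu>. \<mu> \<noteq> {} \<and> \<mu> \<subseteq> \<tau>} =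
    realization {\<mu>. \<mu> \<noteq> {} \<and> \<mu> \<subset> \<tau> \<and> \<mu> \<noteq> \<sigma>}" (is "_ ` realization ?F = realization ?H")
proof
  have F: "?F \<subseteq> L" using abs_complexD(3)[OF L(2) \<sigma>(3)] by auto
  show "push \<sigma> a 1 ` realization ?F \<subseteq> realization ?H"
  proof (rule image_subsetI)
    fix x assume x: "x \<in> realization ?F"
    then have xL: "x \<in> realization L" using realization_mono[OF F] by blast
    have "supp x \<subseteq> \<tau>" using x by (simp add: realization_def)
    then have "supp (push \<sigma> a 1 x) \<subseteq> \<tau>" using push_in(2)[OF xL, of 1] by simp
    moreover have "supp (push \<sigma> a 1 x) \<in> L'" using push_1_in[OF xL] by (simp add: realization_def)
    ultimately have "supp (push \<sigma> a 1 x) \<in> ?H" using abs_complexD(2)[OF L(2)] by auto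
    then show "push \<sigma> a 1 x \<in> realization ?H" using push_1_in[OF xL] by (simp add: realization_def)
  qed
  show "realization ?H \<subseteq> push \<sigma> a 1 ` realization ?F"
  proof
    fix x assume x: "x \<in> realization ?H"
    have "?H \<subseteq> L'" using F by auto
    then have "push \<sigma> a 1 x = x" by (intro push_fix subsetD[OF realization_mono x])
    moreover have "x \<in> realization ?F" using x by (simp add: realization_def psubset_imp_subset)
    ultimately show "x \<in> push \<sigma> a 1 ` realization ?F" by (metis imageI)
  qed
qed

end

section \<open>The composite collapse of a dominated star\<close>

text \<open>\<open>drain\<close> at time 0 sees only the positive parts of \<open>x w - x v\<close>
  for \<open>w\<close> other than \<open>a\<close>. On \<sigma> both terms drop equally; off \<tau>,
  if anything moves at all, \<open>x w = 0\<close> and both positive parts vanish. So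
  \<open>drain\<close> absorbs every \<open>push\<close>.\<close>

lemma (in dominated_vertex) drain_push:
  assumes ec: "elementary_collapse L \<sigma> a" and x: "x \<in> realization L" and v: "v \<in> \<sigma>"
  shows "drain V v a 0 (push \<sigma> a 1 x) = drain V v a 0 x"
proof -
  interpret elementary_collapse L \<sigma> a by (rule ec)
  define m where "m = Min (x ` \<sigma>)"
  have key: "max 0 (push \<sigma> a 1 x w - push \<sigma> a 1 x v) = max 0 (x w - x v)" if "w \<noteq> a" for w
  proof (cases "w \<in> \<sigma> \<or> m = 0")
    case True
    then show ?thesis using that v vV(3) \<sigma>(2) by (auto simp: push_def m_def)
  next
    case False
    then have "supp x \<subseteq> \<tau>" using Min_pos(4)[OF x] by (auto simp: m_def)
    then have "x w = 0" using False that by (auto simp: supp_def)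
    moreover have "m \<le> x v" using Min_pos(2)[OF x v] by (simp add: m_def)
    moreover have "0 \<le> m" using Min_pos(1)[OF x] by (simp add: m_def)
    ultimately show ?thesis using False that v vV(3) by (simp add: push_def m_def[symmetric])
  qed
  then have "(\<Sum>u\<in>W. max 0 (push \<sigma> a 1 x u - push \<sigma> a 1 x v)) = (\<Sum>u\<in>W. max 0 (x u - x v))"
    by (intro sum.cong) auto
  then show ?thesis using key by (auto simp: drain_def fun_eq_iff)
qed

text \<open>Induction over complexes between the deletion and \<open>B\<close> that remain closed
  under adding \<open>a\<close>. Each step removes a pair \<sigma>, \<open>insert a \<sigma>\<close>
  with \<sigma> of maximal size among the simplices containing \<open>v\<close> but not
  \<open>a\<close>; \<open>drain\<close> absorbs its retraction and is the identity on the
  deletion.\<close>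

lemma (in dominated_vertex) collapsed_dominated_star:
  assumes fin: "finite B" and p: "collapsed Cr (deletion B v) Y p"
    and Cr: "\<And>\<sigma>. \<sigma> \<in> B \<Longrightarrow> v \<in> \<sigma> \<Longrightarrow> \<sigma> \<notin> Cr"
    and L: "deletion B v \<subseteq> L" "L \<subseteq> B" "abs_complex L" "\<And>\<sigma>. \<sigma> \<in> L \<Longrightarrow> v \<in> \<sigma> \<Longrightarrow> insert a \<sigma> \<in> L"
  shows "\<exists>p'. collapsed Cr L Y p' \<and> (\<forall>x\<in>realization L. p' x = p (drain V v a 0 x))"
  using L
proof (induction "card (L - deletion B v)" arbitrary: L rule: less_induct)
  case less
  note sub = less.prems(1,2) and cplx = less.prems(3) and cl = less.prems(4)
  have finL: "finite L" using sub fin finite_subset by blast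
  define S where "S = {\<sigma> \<in> L. v \<in> \<sigma> \<and> a \<notin> \<sigma>}"
  have minus: "\<nu> - {a} \<in> S" if "\<nu> \<in> L" "v \<in> \<nu>" for \<nu>
    using abs_complexD(3)[OF cplx that(1), of "\<nu> - {a}"] that vV by (auto simp: S_def)
  show ?case
  proof (cases "S = {}")
    case True
    then have "L = deletion B v" using minus sub by (auto simp: deletion_def)
    then show ?thesis using p drain_deletion[of _ 0] by auto
  next
    case False
    have finS: "finite S" using finL by (simp add: S_def)
    have "Max (card ` S) \<in> card ` S" using finS False by (intro Max_in) auto
    then obtain \<sigma> where \<sigma>: "\<sigma> \<in> S" "card \<sigma> = Max (card ` S)" by auto
    have \<sigma>L: "\<sigma> \<in> L" "v \<in> \<sigma>" "a \<notin> \<sigma>" "insert a \<sigma> \<in> L" using \<sigma>(1) cl by (auto simp: S_def)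
    \<comment> \<open>Removing \<open>a\<close> from a simplex containing \<sigma> gives a member of
      \<open>S\<close>, so maximality leaves no third candidate. This is freeness, and it also keeps
      the smaller family a complex.\<close>
    have max: "\<nu> \<in> {\<sigma>, insert a \<sigma>}" if n: "\<nu> \<in> L" "\<sigma> \<subseteq> \<nu>" for \<nu>
    proof -
      have "v \<in> \<nu>" using n \<sigma>L by auto
      then have "card (\<nu> - {a}) \<le> card \<sigma>" using minus[OF n(1)] finS \<sigma>(2) by simp
      moreover have "finite (\<nu> - {a})" using abs_complexD(1)[OF cplx n(1)] by simp
      ultimately have "\<sigma> = \<nu> - {a}" using n(2) \<sigma>L(3) by (intro card_seteq) auto
      then show ?thesis by auto
    qed
    interpret ec: elementary_collapse L \<sigma> a
    proof
      show "{\<rho> \<in> L. \<sigma> \<subset> \<rho>} = {insert a \<sigma>}" using max \<sigma>L by auto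
    qed (use finL cplx \<sigma>L in auto)
    let ?L = "L - {\<sigma>, insert a \<sigma>}"
    have L1: "deletion B v \<subseteq> ?L" using sub(1) \<sigma>L by (auto simp: deletion_def)
    have L2: "abs_complex ?L"
      unfolding abs_complex_def
    proof (intro conjI ballI allI impI)
      fix \<nu> \<mu> assume n: "\<nu> \<in> ?L" "\<mu> \<subseteq> \<nu> \<and> \<mu> \<noteq> {}"
      then have "\<mu> \<in> L" using abs_complexD(3)[OF cplx] by blast
      moreover have "\<mu> \<notin> {\<sigma>, insert a \<sigma>}" using max[of \<nu>] n by blast
      ultimately show "\<mu> \<in> ?L" by blast
    qed (use abs_complexD[OF cplx] in auto)
    have L3: "insert a \<mu> \<in> ?L" if m: "\<mu> \<in> ?L" "v \<in> \<mu>" for \<mu>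
    proof -
      have "insert a \<mu> \<in> L" using cl m by auto
      moreover have "insert a \<mu> \<noteq> \<sigma>" using \<sigma>L(3) by auto
      moreover have "insert a \<mu> \<noteq> insert a \<sigma>"
      proof
        assume eq: "insert a \<mu> = insert a \<sigma>"
        then have "\<sigma> \<subseteq> \<mu> \<or> \<mu> = \<sigma>" using \<sigma>L(3) by (cases "a \<in> \<mu>") auto
        then show False using max[of \<mu>] m by auto
      qed
      ultimately show ?thesis by auto
    qed
    have L4: "card (?L - deletion B v) < card (L - deletion B v)"
    proof (rule psubset_card_mono)
      show "?L - deletion B v \<subset> L - deletion B v" using \<sigma>L by (auto simp: deletion_def)
    qed (use finL in auto)
    have "?L \<subseteq> B" using sub(2) by auto
    from less.hyps[OF L4 L1 this L2 L3] obtain p'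
      where p': "collapsed Cr ?L Y p'" "\<forall>x\<in>realization ?L. p' x = p (drain V v a 0 x)"
      by blast
    have "collapsed Cr L Y (p' \<circ> push \<sigma> a 1)"
    proof (rule collapsed.pair[OF p'(1) cplx])
      show "\<sigma> \<prec>\<^sub>s insert a \<sigma>" using \<sigma>L(3) ec.fin_\<sigma> by (simp add: facet_of_def subset_insertI)
      show "free_face L \<sigma> (insert a \<sigma>)" using \<sigma>L ec.free by (simp add: free_face_def)
    qed (use \<sigma>L sub Cr ec.push_strong_deformation_retraction ec.push_image in auto)
    moreover have "(p' \<circ> push \<sigma> a 1) x = p (drain V v a 0 x)" if "x \<in> realization L" for x
      using p'(2) ec.push_1_in[OF that] drain_push[OF ec.elementary_collapse_axioms that \<sigma>L(2)] by simp
    ultimately show ?thesis by blast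
  qed
qed

section \<open>Attaching the star of a critical vertex\<close>

text \<open>Attaching in two stages equals attaching at once, literally and not just up to
  homeomorphism: both live on the same points, and the two stage maps into the quotient
  coincide.\<close>

lemma pushout_space_trans:
  assumes AB: "A \<subseteq> B" "B \<subseteq> X" and p: "p ` A \<subseteq> topspace Y" and Y: "topspace Y \<subseteq> A"
  shows "pushout_space (top_of_set X) B (pushout_map A p) (pushout_space (top_of_set B) A p Y)
    = pushout_space (top_of_set X) A p Y" (is "?l = ?r")
proof (rule topology_eq[THEN iffD2], rule allI)
  fix U
  let ?M = "pushout_space (top_of_set B) A p Y"
  have tM: "topspace ?M = topspace Y \<union> (B - A)"
    by (subst topspace_pushout_space) (use p in auto)
  have pm: "pushout_map B (pushout_map A p) = pushout_map A p"
    using AB by (auto simp: pushout_map_def fun_eq_iff)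
  have e: "topspace Y \<inter> (topspace ?M \<inter> U) = topspace Y \<inter> U" unfolding tM by auto
  have "{x \<in> B. pushout_map A p x \<in> topspace ?M \<inter> U} = B \<inter> {x \<in> X. pushout_map A p x \<in> U}"
    unfolding tM using p AB by (auto simp: pushout_map_def)
  then have "openin (top_of_set B) {x \<in> B. pushout_map A p x \<in> topspace ?M \<inter> U}"
    if "openin (top_of_set X) {x \<in> X. pushout_map A p x \<in> U}"
    using openin_subtopology_Int2[OF that, of B] AB(2)
    by (simp add: subtopology_subtopology Int_absorb1)
  then show "openin ?l U = openin ?r U"
    unfolding openin_pushout_space[of "top_of_set X"] pm openin_pushout_space[of "top_of_set B"] e
    unfolding tM using AB by auto
qed

text \<open>Peel off a new simplex of maximal dimension; what remains is a complex, and
  \<open>pushout_space_trans\<close> merges its pushout with the last cell.\<close>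

lemma collapsed_critical:
  assumes "finite B" "abs_complex B" "A \<subseteq> B" "A \<noteq> B" and A: "collapsed Cr A Y p" and "B - A \<subseteq> Cr"
  shows "collapsed Cr B (pushout_space (top_of_set (realization B)) (realization A) p Y)
    (pushout_map (realization A) p)"
  using assms(1-4,6)
proof (induction "card B" arbitrary: B rule: less_induct)
  case less
  have fin: "finite (B - A)" "B - A \<noteq> {}" using less.prems by auto
  then have "Max (card ` (B - A)) \<in> card ` (B - A)" by (intro Max_in) auto
  then obtain \<sigma> where \<sigma>: "\<sigma> \<in> B - A" "card \<sigma> = Max (card ` (B - A))" by auto
  have max: "\<nu> = \<sigma>" if n: "\<nu> \<in> B" "\<sigma> \<subseteq> \<nu>" for \<nu>
  proof -
    have "\<nu> \<notin> A"
      using n \<sigma> abs_complexD(3)[OF collapsed_abs_complex[OF A], of \<nu> \<sigma>]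
        abs_complexD(2)[OF less.prems(2), of \<sigma>] by auto
    then have "card \<nu> \<le> card \<sigma>" using n \<sigma>(2) fin by simp
    then show ?thesis using n(2) abs_complexD(1)[OF less.prems(2) n(1)] card_seteq by blast
  qed
  let ?B = "B - {\<sigma>}"
  have B: "B = insert \<sigma> ?B" using \<sigma> by auto
  show ?case
  proof (cases "?B = A")
    case True
    then have "B = insert \<sigma> A" "\<sigma> \<notin> A" "\<sigma> \<in> Cr" using B \<sigma>(1) less.prems(5) by auto
    then show ?thesis by (rule collapsed.crit[OF A less.prems(2)])
  next
    case False
    have B1: "abs_complex ?B"
      unfolding abs_complex_def
    proof (intro conjI ballI allI impI)
      fix \<nu> \<mu> assume n: "\<nu> \<in> ?B" "\<mu> \<subseteq> \<nu> \<and> \<mu> \<noteq> {}"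
      then have "\<mu> \<in> B" using abs_complexD(3)[OF less.prems(2)] by blast
      moreover have "\<mu> \<noteq> \<sigma>" using max[of \<nu>] n by blast
      ultimately show "\<mu> \<in> ?B" by blast
    qed (use abs_complexD[OF less.prems(2)] in auto)
    have B2: "card ?B < card B" using less.prems(1) \<sigma>(1) by (intro psubset_card_mono) auto
    have IH: "collapsed Cr ?B (pushout_space (top_of_set (realization ?B)) (realization A) p Y)
        (pushout_map (realization A) p)"
      by (rule less.hyps[OF B2]) (use less.prems \<sigma> False B1 in auto)
    have sub: "realization A \<subseteq> realization ?B" "realization ?B \<subseteq> realization B"
      using \<sigma> less.prems(3) by (auto intro!: realization_mono)
    have "p ` realization A \<subseteq> topspace Y"
      using continuous_map_image_subset_topspace[OF collapsed_continuous[OF A]] by simp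
    note tr = pushout_space_trans[OF sub this collapsed_topspace[OF A]]
    have "pushout_map (realization ?B) (pushout_map (realization A) p) = pushout_map (realization A) p"
      using sub by (auto simp: pushout_map_def fun_eq_iff)
    moreover have "\<sigma> \<notin> ?B" "\<sigma> \<in> Cr" using \<sigma>(1) less.prems(5) by auto
    ultimately show ?thesis
      using collapsed.crit[OF IH less.prems(2) B] tr by simp
  qed
qed

section \<open>Comparison of the two cores\<close>

locale core_choice =
  fixes K :: "'v set set" and g :: "'v \<Rightarrow> real" and vs a
  assumes K: "finite K" "abs_complex K" and choice: "strong_core_choice K g vs a"
begin

abbreviation "Cr \<equiv> \<Union>w\<in>strong_critical K g. desc_star K g w"

lemma vs: "distinct vs" "set vs = vertices K"
  using choice by (auto simp: strong_core_choice_def)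

lemma g_mono: "i \<le> j \<Longrightarrow> j < length vs \<Longrightarrow> g (vs ! i) \<le> g (vs ! j)"
  using choice unfolding strong_core_choice_def by (metis order_le_less order_refl)

lemma initial_complex:
  "finite (initial_complex K vs i)" "abs_complex (initial_complex K vs i)" "initial_complex K vs i \<subseteq> K"
  using K unfolding initial_complex_def full_subcomplex_def abs_complex_def by (auto; blast)+

lemma initial_complex_all: "initial_complex K vs (length vs) = K"
proof -
  have "\<sigma> \<subseteq> vertices K" if "\<sigma> \<in> K" for \<sigma>
    using abs_complexD(3)[OF K(2) that] by (auto simp: vertices_def)
  then show ?thesis using vs by (auto simp: initial_complex_def full_subcomplex_def)
qed

lemma deletion_initial_complex:
  assumes "i < length vs"
  shows "deletion (initial_complex K vs (Suc i)) (vs ! i) = initial_complex K vs i"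
proof -
  have "vs ! i \<notin> set (take i vs)"
    using assms vs(1) by (metis distinct_take id_take_nth_drop not_distinct_conv_prefix take_Suc_conv_app_nth)
  then show ?thesis
    using assms by (auto simp: deletion_def initial_complex_def full_subcomplex_def take_Suc_conv_app_nth)
qed

lemma vertex_in_initial_complex:
  assumes "i < length vs"
  shows "{vs ! i} \<in> initial_complex K vs (Suc i)"
proof -
  have "vs ! i \<in> vertices K" using assms vs(2) nth_mem by blast
  then show ?thesis
    using assms by (auto simp: vertices_def initial_complex_def full_subcomplex_def take_Suc_conv_app_nth)
qed

lemma initial_complex_le:
  assumes "i < length vs" "\<sigma> \<in> initial_complex K vs (Suc i)" "x \<in> \<sigma>"
  shows "\<exists>j\<le>i. x = vs ! j" "g x \<le> g (vs ! i)"
proof -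
  have "x \<in> set (take (Suc i) vs)" using assms by (auto simp: initial_complex_def full_subcomplex_def)
  then show "\<exists>j\<le>i. x = vs ! j" using assms(1) by (auto simp: in_set_conv_nth less_Suc_eq_le)
  then show "g x \<le> g (vs ! i)" using g_mono assms(1) by blast
qed

lemma critical_star:
  assumes i: "i < length vs" and nd: "\<not> desc_dominated K g (vs ! i)"
    and \<sigma>: "\<sigma> \<in> initial_complex K vs (Suc i)" "vs ! i \<in> \<sigma>"
  shows "\<sigma> \<in> Cr"
proof -
  have "vs ! i \<in> strong_critical K g" using nd vs(2) nth_mem[OF i] by (simp add: strong_critical_def)
  moreover have "\<sigma> \<in> desc_star K g (vs ! i)"
    using initial_complex_le(2)[OF i \<sigma>(1)] \<sigma> initial_complex(3)
    by (auto simp: desc_star_def star_def sublevel_def)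
  ultimately show ?thesis by blast
qed

text \<open>A strong critical \<open>w\<close> whose descending star contains \<sigma> would have
  the same value as \<open>vs ! i\<close> and an earlier position, but dominated vertices come first
  among equal values.\<close>

lemma dominated_star:
  assumes i: "i < length vs" and d: "desc_dominated K g (vs ! i)"
    and \<sigma>: "\<sigma> \<in> initial_complex K vs (Suc i)" "vs ! i \<in> \<sigma>"
  shows "\<sigma> \<notin> Cr"
proof
  assume "\<sigma> \<in> Cr"
  then obtain w where w: "w \<in> strong_critical K g" "w \<in> \<sigma>" "g (vs ! i) \<le> g w"
    using \<sigma>(2) by (auto simp: desc_star_def star_def sublevel_def)
  then obtain j where j: "j \<le> i" "w = vs ! j" using initial_complex_le(1)[OF i \<sigma>(1)] by blast
  have "g w \<le> g (vs ! i)" using w(2) by (rule initial_complex_le(2)[OF i \<sigma>(1)])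
  then have eq: "g (vs ! j) = g (vs ! i)" using w(3) j(2) by simp
  have nd: "\<not> desc_dominated K g (vs ! j)" using w(1) j(2) by (simp add: strong_critical_def)
  then have "j < i" using d j(1) by (cases "j = i") auto
  then show False using choice i eq d nd unfolding strong_core_choice_def by blast
qed

text \<open>Domination is given in the sublevel complex, which may contain later vertices of equal
  value. It passes to the initial complex because \<open>g (a v) < g v\<close> puts the dominating
  vertex before \<open>v\<close>.\<close>

lemma dominated_vertex:
  assumes i: "i < length vs" and d: "desc_dominated K g (vs ! i)"
  shows "dominated_vertex (initial_complex K vs (Suc i)) (vs ! i) (a (vs ! i)) (\<Union>K)"
proof
  let ?v = "vs ! i" and ?a = "a (vs ! i)" and ?B = "initial_complex K vs (Suc i)"
  have vK: "?v \<in> vertices K" using i vs(2) nth_mem by blast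
  then have da: "desc_dominated_by K g ?v ?a"
    using choice d by (simp add: strong_core_choice_def)
  then obtain K0 where ga: "g ?a < g ?v"
    and lk: "link ?v (sublevel K g (g ?v)) = simplicial_cone ?a K0"
    by (auto simp: desc_dominated_by_def dominated_by_def)
  have aK: "{?a, ?v} \<in> K"
  proof -
    have "{?a} \<in> link ?v (sublevel K g (g ?v))" unfolding lk by (simp add: simplicial_cone_def)
    then show ?thesis by (auto simp: link_def sublevel_def insert_commute)
  qed
  then have "{?a} \<in> K" using abs_complexD(3)[OF K(2), of "{?a, ?v}" "{?a}"] by simp
  then have "?a \<in> set vs" using vs(2) by (simp add: vertices_def)
  then obtain k where k: "k < length vs" "vs ! k = ?a" by (auto simp: in_set_conv_nth)
  have "k < i"
  proof (rule ccontr)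
    assume "\<not> k < i"
    then have "g ?v \<le> g (vs ! k)" using g_mono k(1) by simp
    then show False using k(2) ga by simp
  qed
  then have a_take: "?a \<in> set (take (Suc i) vs)"
    using k i by (auto simp: in_set_conv_nth intro!: exI[of _ k])
  show "finite (\<Union>K)" using finite_Union_complex[OF K] .
  show "\<Union>?B \<subseteq> \<Union>K" using initial_complex(3) by blast
  show "?v \<in> \<Union>K" "?a \<in> \<Union>K" using aK by auto
  show "?v \<noteq> ?a" using ga by auto
  show "abs_complex ?B" by (rule initial_complex)
  fix \<sigma> assume \<sigma>: "\<sigma> \<in> ?B" "?v \<in> \<sigma>"
  have "insert ?a \<sigma> \<in> K"
  proof (cases "\<sigma> = {?v}")
    case True
    then show ?thesis using aK by simp
  next
    case False
    have \<sigma>K: "\<sigma> \<in> sublevel K g (g ?v)"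
      using initial_complex_le(2)[OF i \<sigma>(1)] \<sigma>(1) initial_complex(3) by (auto simp: sublevel_def)
    have "\<sigma> - {?v} \<in> sublevel K g (g ?v)"
      using abs_complexD(3)[OF K(2), of \<sigma> "\<sigma> - {?v}"] \<sigma>K False \<sigma>(2) by (auto simp: sublevel_def)
    then have "\<sigma> - {?v} \<in> link ?v (sublevel K g (g ?v))"
      using \<sigma>K \<sigma>(2) by (simp add: link_def deletion_def insert_absorb)
    \<comment> \<open>A cone is closed under adding its apex; this is all that is used to enlarge
      \<sigma>.\<close>
    moreover have "\<mu> \<union> {?a} \<in> simplicial_cone ?a K0" if "\<mu> \<in> simplicial_cone ?a K0" for \<mu>
      using that unfolding simplicial_cone_def by (elim UnE) (force simp: insert_absorb)+
    ultimately have "\<sigma> - {?v} \<union> {?a} \<in> link ?v (sublevel K g (g ?v))"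
      unfolding lk by blast
    then have "\<sigma> - {?v} \<union> {?a} \<union> {?v} \<in> K" by (simp add: link_def sublevel_def)
    moreover have "\<sigma> - {?v} \<union> {?a} \<union> {?v} = insert ?a \<sigma>" using \<sigma>(2) by auto
    ultimately show ?thesis by simp
  qed
  then show "insert ?a \<sigma> \<in> ?B" using \<sigma>(1) a_take by (simp add: initial_complex_def full_subcomplex_def)
qed

text \<open>Only \<open>c 0\<close> occurs in the comparison, but the whole family is carried along:
  coning off at a critical vertex uses its positive times.\<close>

lemma stage_comparison:
  assumes "i \<le> length vs"
  shows "\<exists>Y p c \<phi>. collapsed Cr (initial_complex K vs i) Y p \<and>
    pseudo_isotopy (initial_complex K vs i) c \<and>
    homeomorphic_map Y (fst (strong_stage K g vs a i)) \<phi> \<and>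
    (\<forall>x\<in>realization (initial_complex K vs i). \<phi> (p x) = snd (strong_stage K g vs a i) (c 0 x))"
  using assms
proof (induction i)
  case 0
  have e: "initial_complex K vs 0 = {}"
    using K(2) by (auto simp: initial_complex_def full_subcomplex_def abs_complex_def)
  have "pseudo_isotopy {} (\<lambda>_. id)" by (simp add: pseudo_isotopy_def)
  moreover have "homeomorphic_map (top_of_set {}) (top_of_set {}) id" by simp
  ultimately show ?case
    unfolding e using collapsed.empty[of Cr] by (metis fst_conv realization_empty empty_iff strong_stage.simps(1))
next
  case (Suc i)
  then have i: "i < length vs" by simp
  let ?A = "initial_complex K vs i" and ?B = "initial_complex K vs (Suc i)" and ?v = "vs ! i"
  obtain Z q where Z: "strong_stage K g vs a i = (Z, q)" by fastforce
  obtain Y p c \<phi> where Y: "collapsed Cr ?A Y p" and c: "pseudo_isotopy ?A c"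
    and \<phi>: "homeomorphic_map Y Z \<phi>" and com: "\<And>x. x \<in> realization ?A \<Longrightarrow> \<phi> (p x) = q (c 0 x)"
    using Suc.IH i Z by auto
  note del = deletion_initial_complex[OF i]
  show ?case
  proof (cases "desc_dominated K g ?v")
    case True
    interpret dominated_vertex ?B ?v "a ?v" "\<Union>K" by (rule dominated_vertex[OF i True])
    have c': "pseudo_isotopy (deletion ?B ?v) c" and Y': "collapsed Cr (deletion ?B ?v) Y p"
      using c Y del by simp_all
    obtain p' where p': "collapsed Cr ?B Y p'" "\<forall>x\<in>realization ?B. p' x = p (drain (\<Union>K) ?v (a ?v) 0 x)"
      using collapsed_dominated_star[OF initial_complex(1) Y' dominated_star[OF i True], of ?B] dom B
      by (auto simp: deletion_def)
    \<comment> \<open>\<open>p'\<close> is \<open>p\<close> after \<open>drain\<close>; the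
      induction hypothesis turns \<open>p\<close> into \<open>q\<close> after \<open>c 0\<close>,
      and \<open>c 0\<close> after \<open>drain\<close> is the retraction of the lifted
      point.\<close>
    have "\<phi> (p' x) = (q \<circ> domination_retraction ?v (a ?v)) (dominated_ext (\<Union>K) ?v (a ?v) c 0 x)"
      if x: "x \<in> realization ?B" for x
      using p'(2) x com[of "drain (\<Union>K) ?v (a ?v) 0 x"] drain_in(1)[OF x, of 0]
        dominated_ext_in(3)[OF c' x, of 0] del by simp
    moreover have st: "strong_stage K g vs a (Suc i) = (Z, q \<circ> domination_retraction ?v (a ?v))"
      using Z True by (simp add: Let_def)
    ultimately show ?thesis
      unfolding st fst_conv snd_conv using p'(1) dominated_ext_pseudo_isotopy[OF c'] \<phi> by blast
  next
    case False
    let ?X = "realization ?B" and ?A' = "realization ?A"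
    have V: "finite (\<Union>K)" "\<Union>?B \<subseteq> \<Union>K"
      using finite_Union_complex[OF K] initial_complex(3)[of "Suc i"] by auto
    have vV: "?v \<in> \<Union>K" using vertex_in_initial_complex[OF i] V(2) by blast
    note cone = V vV initial_complex(2)[of "Suc i"] c[folded del]
    let ?C = "cone_ext ?v c"
    have C: "pseudo_isotopy ?B ?C" by (rule cone_ext_pseudo_isotopy[OF cone])
    have CA: "?C 0 x = c 0 x" if "x \<in> ?A'" for x
      using cone_ext_deletion[OF cone, of 0 x] that del by simp
    have AB: "?A \<subseteq> ?B" using del by (auto simp: deletion_def)
    have "?A \<noteq> ?B" using vertex_in_initial_complex[OF i] del[symmetric] by (auto simp: deletion_def)
    moreover have "?B - ?A \<subseteq> Cr" using critical_star[OF i False] del[symmetric] by (auto simp: deletion_def)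
    ultimately have coll: "collapsed Cr ?B (pushout_space (top_of_set ?X) ?A' p Y) (pushout_map ?A' p)"
      by (intro collapsed_critical initial_complex AB Y)
    have c0: "c 0 ` ?A' = ?A'" by (rule pseudo_isotopy_0_surj[OF initial_complex(1,2) c])
    have pY: "p ` ?A' \<subseteq> topspace Y"
      using continuous_map_image_subset_topspace[OF collapsed_continuous[OF Y]] by simp
    \<comment> \<open>Surjectivity of \<open>c 0\<close> transfers the range of \<phi> after
      \<open>p\<close> to \<open>q\<close>.\<close>
    have qZ: "q ` ?A' \<subseteq> topspace Z"
    proof -
      have "q ` ?A' = q ` (c 0 ` ?A')" using c0 by simp
      also have "\<dots> = \<phi> ` (p ` ?A')" using com by (simp add: image_image)
      also have "\<dots> \<subseteq> topspace Z" using \<phi> pY by (metis homeomorphic_imp_surjective_map image_mono)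
      finally show ?thesis .
    qed
    have "\<exists>\<Phi>. homeomorphic_map (pushout_space (top_of_set ?X) ?A' p Y) (pushout_space (top_of_set ?X) ?A' q Z) \<Phi> \<and>
      (\<forall>x\<in>?X. \<Phi> (pushout_map ?A' p x) = pushout_map ?A' q (?C 0 x))"
    proof (rule pushout_homeomorphic_map[OF _ _ _ _ _ _ \<phi> pY qZ])
      show "compact ?X" by (intro compact_realization initial_complex)
      show "?A' \<subseteq> ?X" by (rule realization_mono[OF AB])
      have "continuous_on ?X (\<lambda>x. ?C ((\<lambda>_. 0) x) (id x))"
        by (rule pseudo_isotopy_compose[OF C]) (auto intro: continuous_on_id continuous_on_const)
      then show "continuous_on ?X (?C 0)" by simp
      show "?C 0 ` ?X = ?X" by (rule pseudo_isotopy_0_surj[OF initial_complex(1,2) C])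
      show "?C 0 ` ?A' \<subseteq> ?A'" using CA c0 by auto
      show "bij_betw (?C 0) (?X - ?A') (?X - ?A')" using cone_ext_0_bij[OF cone] del by simp
      show "\<phi> (p x) = q (?C 0 x)" if "x \<in> ?A'" for x using com CA that by simp
      show "topspace Y \<inter> (?X - ?A') = {}" using collapsed_topspace[OF Y] by blast
      show "topspace Z \<inter> (?X - ?A') = {}" using topspace_strong_stage[of K g vs a i] Z by auto
    qed
    moreover have st: "strong_stage K g vs a (Suc i) =
        (pushout_space (top_of_set ?X) ?A' q Z, pushout_map ?A' q)"
      using Z False by (simp add: Let_def)
    ultimately show ?thesis unfolding st fst_conv snd_conv using coll C by blast
  qed
qed

end

theorem theorem3p9:
  fixes K :: "'v set set" and g :: "'v \<Rightarrow> real"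
  assumes "finite K" and "abs_complex K"
  shows "(\<exists>f. discrete_morse K f \<and>
             critical_simplices K f = (\<Union>w\<in>strong_critical K g. desc_star K g w))
    \<and> (\<forall>vs a. strong_core_choice K g vs a \<longrightarrow>
         (\<exists>f. discrete_morse K f \<and>
             critical_simplices K f = (\<Union>w\<in>strong_critical K g. desc_star K g w) \<and>
             (\<exists>m L \<rho>. internal_core_choice K f m L \<rho> \<and>
                strong_core K g vs a homeomorphic_space internal_core m L \<rho>)))"
proof -
  have main: "\<exists>f. discrete_morse K f \<and>
      critical_simplices K f = (\<Union>w\<in>strong_critical K g. desc_star K g w) \<and>
      (\<exists>m L \<rho>. internal_core_choice K f m L \<rho> \<and>
        strong_core K g vs a homeomorphic_space internal_core m L \<rho>)"
    if "strong_core_choice K g vs a" for vs a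
  proof -
    interpret core_choice K g vs a using assms that by unfold_locales
    obtain Y p \<phi> where Y: "collapsed Cr K Y p" and \<phi>: "homeomorphic_map Y (strong_core K g vs a) \<phi>"
      using stage_comparison[of "length vs"] unfolding initial_complex_all strong_core_def by blast
    obtain m L \<rho> where L: "L 0 = {}" "L m = K" "\<And>j. j \<le> m \<Longrightarrow> abs_complex (L j)"
        "\<And>j. j < m \<Longrightarrow> elementary_step Cr (L j) (L (Suc j)) (\<rho> j)" "collapse_stage L \<rho> m = (Y, p)"
      using collapsed_imp_filtration[OF Y] by blast
    have "Cr \<subseteq> K" by (auto simp: desc_star_def star_def sublevel_def)
    then obtain f where f: "discrete_morse K f" "critical_simplices K f = Cr" "internal_core_choice K f m L \<rho>"
      using filtration_morse_function[OF L(1-4)] by blast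
    have "internal_core m L \<rho> = Y" using L(5) by (simp add: internal_core_def)
    then have "strong_core K g vs a homeomorphic_space internal_core m L \<rho>"
      using \<phi> homeomorphic_map_imp_homeomorphic_space homeomorphic_space_sym by blast
    then show ?thesis using f by blast
  qed
  \<comment> \<open>An admissible choice exists, so the first claim is an instance of the
    second.\<close>
  moreover have "\<exists>vs a. strong_core_choice K g vs a" using assms by (rule ex_strong_core_choice)
  ultimately show ?thesis by blast
qed

end
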